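(* Fix a real number $\lambda > 8$. For each $n\ge 1$, let $z\in\{\pm1\}^n$ be a fixed vector, let $\sigma = \sqrt{n}/\lambda$ (so that $\lambda>8$ is equivalent to $\sigma<\frac18\sqrt n$), and let $Y = zz^T+\sigma W$, where $W\in\mathbb{R}^{n\times n}$ is a random symmetric matrix with $W_{ii}=0$ for all $i$ and with entries $W_{ij}$, $i>j$, i.i.d. $\mathcal{N}(0,1)$. Then there exists $\varepsilon>0$ (depending on $\lambda$ but not on $n$) such that, with high probability, every second-order critical point $Q\in\mathbb{R}^{n\times 2}$ of the problem $$\max_{Q\in\mathbb{R}^{n\times 2}} \operatorname{Tr}(Q^TYQ)\quad\text{s.t. } \|Q_{i:}\|_2^2=1,\ 1\le i\le n,$$ satisfies $$\frac1n\|Q^Tz\|_2\ge \varepsilon.$$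
   Context: $Q_{i:}$ denotes the $i$th row of $Q$. "With high probability" means with probability tending to $1$ as $n\to\infty$. The operator $\mathrm{ddiag}$ maps a square matrix to the diagonal matrix obtained by setting all off-diagonal entries to zero; $\circ$ is the entrywise (Hadamard) product. For a symmetric cost matrix $A\in\mathbb{R}^{n\times n}$, a second-order critical point of $\max\{\operatorname{Tr}(Q^TAQ): Q\in\mathbb{R}^{n\times 2},\ \|Q_{i:}\|_2=1\ \forall i\}$ is a feasible $Q$ satisfying the first-order condition $(\mathrm{ddiag}(AQQ^T)-A)Q=0$ and the second-order condition $\mathrm{ddiag}(AQQ^T)-A\circ(QQ^T)\succeq 0$. (The model is equivalently written in rescaled form as $\frac{\lambda}{n}Y=\frac{\lambda}{n}zz^T+\frac{1}{\sqrt n}W$; rescaling by a positive constant does not change the second-order critical points.) *)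

theory Defs
  imports "HOL-Probability.Probability" "Jordan_Normal_Form.Matrix"
begin

text \<open>
  Since the size \<open>n\<close> tends to infinity, matrices are the carrier-based ones of
  \<^theory>\<open>Jordan_Normal_Form.Matrix\<close>, with indices \<open>0..<n\<close>.  The syntax of the dimension-indexed
  vectors of HOL-Analysis, which clashes with it, is switched off.
\<close>

unbundle no vec_syntax
unbundle no inner_syntax
hide_type (open) Finite_Cartesian_Product.vec
hide_const (open) Finite_Cartesian_Product.vec

definition norm2 :: "real vec \<Rightarrow> real" where
  "norm2 v = L2_set (\<lambda>i. v $ i) {..<dim_vec v}"

definition outer_square :: "real vec \<Rightarrow> real mat" where
  "outer_square z = mat (dim_vec z) (dim_vec z) (\<lambda>(i, j). z $ i * z $ j)"

definition hadamard :: "real mat \<Rightarrow> real mat \<Rightarrow> real mat" where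
  "hadamard A B = mat (dim_row A) (dim_col A) (\<lambda>(i, j). A $$ (i, j) * B $$ (i, j))"

definition ddiag :: "real mat \<Rightarrow> real mat" where
  "ddiag A = mat_diag (dim_row A) (\<lambda>i. A $$ (i, i))"

definition pos_semidef :: "nat \<Rightarrow> real mat \<Rightarrow> bool" where
  "pos_semidef n A \<longleftrightarrow>
     A \<in> carrier_mat n n \<and> A\<^sup>T = A \<and> (\<forall>x \<in> carrier_vec n. 0 \<le> x \<bullet> (A *\<^sub>v x))"

definition feasible :: "nat \<Rightarrow> real mat \<Rightarrow> bool" where
  "feasible n Q \<longleftrightarrow> Q \<in> carrier_mat n 2 \<and> (\<forall>i < n. norm2 (row Q i) = 1)"

text \<open>
  Second-order critical points of maximising the trace of \<open>Q\<^sup>T * A * Q\<close> over the feasible \<open>Q\<close>,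
  for a symmetric cost matrix \<open>A\<close> of size \<open>n\<close>.  As \<open>Q\<close> has two columns, the tangent space of each
  row constraint is a line, and the second-order condition on tangent directions takes the form
  of the last conjunct, the positive semidefiniteness of a single matrix of size \<open>n\<close>.
\<close>

definition second_order_critical :: "nat \<Rightarrow> real mat \<Rightarrow> real mat \<Rightarrow> bool" where
  "second_order_critical n A Q \<longleftrightarrow>
     feasible n Q \<and>
     (ddiag (A * Q * Q\<^sup>T) - A) * Q = 0\<^sub>m n 2 \<and>
     pos_semidef n (ddiag (A * Q * Q\<^sup>T) - hadamard A (Q * Q\<^sup>T))"

definition sign_vec :: "nat \<Rightarrow> real vec \<Rightarrow> bool" where
  "sign_vec n z \<longleftrightarrow> z \<in> carrier_vec n \<and> (\<forall>i < n. z $ i \<in> {1, -1})"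

definition gaussian_noise :: "'a measure \<Rightarrow> nat \<Rightarrow> ('a \<Rightarrow> real mat) \<Rightarrow> bool" where
  "gaussian_noise M n W \<longleftrightarrow>
     prob_space M \<and>
     (\<forall>\<omega> \<in> space M. W \<omega> \<in> carrier_mat n n \<and> (W \<omega>)\<^sup>T = W \<omega> \<and> (\<forall>i < n. W \<omega> $$ (i, i) = 0)) \<and>
     prob_space.indep_vars M (\<lambda>_. borel) (\<lambda>(i, j) \<omega>. W \<omega> $$ (i, j)) {(i, j). j < i \<and> i < n} \<and>
     (\<forall>i < n. \<forall>j < i. distributed M lborel (\<lambda>\<omega>. W \<omega> $$ (i, j)) std_normal_density)"

definition observation :: "real \<Rightarrow> real vec \<Rightarrow> real mat \<Rightarrow> real mat" where
  "observation \<sigma> z W = outer_square z + \<sigma> \<cdot>\<^sub>m W"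

end

theory Submission
  imports Defs "HOL-Real_Asymp.Real_Asymp"
begin

text \<open>
  Write \<open>u i\<close> for the rows of \<open>Q\<close> as complex numbers of modulus 1.  Testing the second-order condition
  against \<open>z i * Re (u i)\<close> and \<open>z i * Im (u i)\<close> and adding up gives
  \<open>|Q\<^sup>T z|\<^sup>2 \<ge> |Q Q\<^sup>T|\<^sup>2 + \<sigma> (\<Sum> W i j z i z j c i j\<^sup>2 - \<Sum> W i j c i j)\<close> with \<open>c i j = Re (u i * cnj (u j))\<close>.
  Here \<open>|Q Q\<^sup>T|\<^sup>2 \<ge> n\<^sup>2 / 2\<close>.  Doubling the angles turns \<open>c i j\<^sup>2\<close> into
  \<open>(1 + Re (u i\<^sup>2 * cnj (u j\<^sup>2))) / 2\<close>, so that up to the negligible term \<open>\<Sum> W i j z i z j / 2\<close> the noise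
  contributes at most \<open>3 / 2\<close> times the supremum of \<open>|\<Sum> W i j Re (v i * cnj (v j))|\<close> over unit \<open>v\<close>.
  As \<open>\<lambda> > 8\<close>, it suffices that this supremum is at most \<open>K n sqrt n\<close> for some \<open>K < 8 / 3\<close>; no sharp bound on the
  norm of \<open>W\<close> is needed.  Since \<open>W\<close> has zero diagonal, the form is affine in each \<open>v i\<close>, and its supremum is at
  most \<open>1 / cos\<^sup>2 (\<pi> / 8)\<close> times its maximum over vertices of the regular octagon.  A Chernoff
  bound, summed over the \<open>8\<^sup>n\<close> choices of vertices, then gives \<open>K = 2.6363\<close>.
\<close>

section \<open>Maximising over the circle and over the octagon\<close>

text \<open>With the rows of a matrix \<open>Q\<close> read as complex numbers \<open>u i\<close>,
  \<open>Re (u i * cnj (u j))\<close> is an entry of the Gram matrix, so this is the trace form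
  \<open>Tr (Q\<^sup>T * w * Q)\<close>.\<close>

definition interaction :: "nat \<Rightarrow> (nat \<Rightarrow> nat \<Rightarrow> real) \<Rightarrow> (nat \<Rightarrow> complex) \<Rightarrow> real" where
  "interaction n w u = (\<Sum>i<n. \<Sum>j<n. w i j * Re (u i * cnj (u j)))"

lemma Re_mult_cnj_commute: "Re (a * cnj b) = Re (b * cnj a)"
  by (simp add: algebra_simps)

text \<open>The eighth roots of unity. Natural-number indices make a choice of one vertex per
  coordinate an element of a finite \<open>PiE\<close> set.\<close>

definition vertex :: "nat \<Rightarrow> complex" where
  "vertex k = cis (pi / 4 * real k)"

lemma norm_vertex [simp]: "cmod (vertex k) = 1"
  by (simp add: vertex_def)

text \<open>The vertices are spaced \<open>pi / 4\<close> apart in angle, so one of them lies within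
  \<open>pi / 8\<close> of the direction of \<open>g\<close>.\<close>

lemma vertex_near_direction: "\<exists>k<8. cos (pi / 8) * cmod g \<le> Re (vertex k * cnj g)"
proof -
  define \<phi> where "\<phi> = Arg g"
  \<comment> \<open>The multiple of \<open>pi / 4\<close> nearest to the angle of \<open>g\<close>;
    its residue \<open>k\<close> modulo 8 names the same vertex.\<close>
  define m where "m = round (\<phi> / (pi / 4))"
  define k where "k = nat (m mod 8)"
  have k: "int k = m mod 8" "k < 8"
    by (auto simp: k_def nat_less_iff)
  have "real_of_int m = real k + 8 * real_of_int (m div 8)"
    using k(1) by (metis of_int_add of_int_mult of_int_numeral of_int_of_nat_eq mod_mult_div_eq)
  then have "pi / 4 * real_of_int m - \<phi> = (pi / 4 * real k - \<phi>) + 2 * pi * of_int (m div 8)"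
    by (simp add: algebra_simps)
  then have per: "cos (pi / 4 * real k - \<phi>) = cos (pi / 4 * real_of_int m - \<phi>)"
    by (simp only: cos_add cos_int_2pin sin_int_2pin mult_1_right mult_zero_right diff_zero)
  have "\<bar>real_of_int m - \<phi> / (pi / 4)\<bar> \<le> 1 / 2"
    unfolding m_def by (rule of_int_round_abs_le)
  then have "\<bar>pi / 4 * (real_of_int m - \<phi> / (pi / 4))\<bar> \<le> pi / 4 * (1 / 2)"
    unfolding abs_mult by (intro mult_mono) auto
  then have near: "\<bar>pi / 4 * real_of_int m - \<phi>\<bar> \<le> pi / 8"
    by (simp add: algebra_simps)
  have "cos (pi / 8) \<le> cos \<bar>pi / 4 * real_of_int m - \<phi>\<bar>"
    using near by (intro cos_monotone_0_pi_le) auto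
  then have "cos (pi / 8) \<le> cos (pi / 4 * real k - \<phi>)"
    unfolding per by simp
  then have "cos (pi / 8) * cmod g \<le> cos (pi / 4 * real k - \<phi>) * cmod g"
    by (intro mult_right_mono) auto
  \<comment> \<open>The polar form holds for \<open>g = 0\<close> as well, so no case distinction is
    needed.\<close>
  also have "\<dots> = Re (vertex k * cnj (rcis (cmod g) (Arg g)))"
    by (simp add: vertex_def \<phi>_def cos_diff algebra_simps)
  also have "\<dots> = Re (vertex k * cnj g)"
    by (simp only: rcis_cmod_Arg)
  finally show ?thesis using k by blast
qed

text \<open>The zero diagonal removes the term quadratic in coordinate \<open>m\<close>. By
  symmetry, row \<open>m\<close> and column \<open>m\<close> contribute equally, whence the factor
  2.\<close>

lemma interaction_update_diff:
  assumes sym: "\<And>i j. i < n \<Longrightarrow> j < n \<Longrightarrow> w i j = w j i"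
    and diag: "\<And>i. i < n \<Longrightarrow> w i i = 0" and m: "m < n"
  shows "interaction n w (u(m := a)) - interaction n w (u(m := b))
    = 2 * Re ((a - b) * cnj (\<Sum>j\<in>{..<n} - {m}. w m j * u j))"
proof -
  let ?N = "{..<n} - {m}"
  have split: "interaction n w (u(m := c)) =
      (\<Sum>i\<in>?N. \<Sum>j\<in>?N. w i j * Re (u i * cnj (u j)))
      + 2 * Re (c * cnj (\<Sum>j\<in>?N. w m j * u j))" for c
  proof -
    let ?v = "u(m := c)"
    have inner: "(\<Sum>j<n. w i j * Re (?v i * cnj (?v j))) =
        w i m * Re (?v i * cnj c) + (\<Sum>j\<in>?N. w i j * Re (?v i * cnj (u j)))" for i
      using m by (subst sum.remove[of _ m]) (auto intro!: sum.cong)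
    have cross: "Re (c * cnj (\<Sum>j\<in>?N. w m j * u j)) = (\<Sum>j\<in>?N. w m j * Re (c * cnj (u j)))"
      by (simp add: sum_distrib_left algebra_simps Re_sum sum.distrib)
    have "interaction n w ?v =
        (\<Sum>j\<in>?N. w m j * Re (c * cnj (u j))) +
        (\<Sum>i\<in>?N. w i m * Re (u i * cnj c) + (\<Sum>j\<in>?N. w i j * Re (u i * cnj (u j))))"
      unfolding interaction_def inner using m diag[OF m]
      by (subst sum.remove[of _ m]) (auto intro!: sum.cong arg_cong2[where f="(+)"])
    also have "(\<Sum>i\<in>?N. w i m * Re (u i * cnj c) + (\<Sum>j\<in>?N. w i j * Re (u i * cnj (u j)))) =
        (\<Sum>i\<in>?N. w m i * Re (c * cnj (u i))) + (\<Sum>i\<in>?N. \<Sum>j\<in>?N. w i j * Re (u i * cnj (u j)))"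
      unfolding sum.distrib using m sym
      by (intro arg_cong2[where f="(+)"] sum.cong refl)
        (auto simp: Re_mult_cnj_commute[of _ c] simp del: times_complex.sel)
    finally show ?thesis unfolding cross by (simp only:)
  qed
  show ?thesis unfolding split
    by (simp add: algebra_simps)
qed

text \<open>As the diagonal of \<open>w\<close> vanishes, the form is affine in each coordinate, so the coordinates can
  be moved one after the other to vertices of the octagon circumscribed to the unit circle.\<close>

lemma interaction_le_vertices:
  assumes sym: "\<And>i j. i < n \<Longrightarrow> j < n \<Longrightarrow> w i j = w j i"
    and diag: "\<And>i. i < n \<Longrightarrow> w i i = 0"
    and u: "\<And>i. i < n \<Longrightarrow> cmod (u i) \<le> 1"
  shows "\<exists>f \<in> {..<n} \<rightarrow>\<^sub>E {..<8}.
    (cos (pi / 8))\<^sup>2 * interaction n w u \<le> interaction n w (\<lambda>i. vertex (f i))"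
proof -
  define c where "c = cos (pi / 8)"
  have c: "c > 0" unfolding c_def by (intro cos_gt_zero) auto
  \<comment> \<open>Coordinates below \<open>m\<close> have already been moved. Dividing by
    \<open>c\<close> enlarges the octagon until it contains the unit disc, so a linear function is
    at least as large at its best vertex as at \<open>u m\<close>, and no move decreases the
    form.\<close>
  have step: "\<exists>f. (\<forall>i. f i < 8) \<and>
      interaction n w u \<le> interaction n w (\<lambda>i. if i < m then vertex (f i) / c else u i)"
    if "m \<le> n" for m
    using that
  proof (induction m)
    case 0
    show ?case by (auto intro!: exI[of _ "\<lambda>_. 0"])
  next
    case (Suc m)
    then obtain f where f: "\<And>i. f i < 8"
      and le: "interaction n w u \<le> interaction n w (\<lambda>i. if i < m then vertex (f i) / c else u i)"
      by auto
    define v where "v = (\<lambda>i. if i < m then vertex (f i) / c else u i)"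
    define g where "g = (\<Sum>j\<in>{..<n} - {m}. w m j * v j)"
    obtain k where k: "k < 8" "c * cmod g \<le> Re (vertex k * cnj g)"
      using vertex_near_direction[of g] unfolding c_def by blast
    have "Re (u m * cnj g) \<le> cmod (u m * cnj g)"
      by (rule complex_Re_le_cmod)
    also have "\<dots> \<le> 1 * cmod g"
      unfolding norm_mult complex_mod_cnj using u[of m] Suc.prems by (intro mult_right_mono) auto
    also have "\<dots> \<le> Re (vertex k * cnj g) / c"
      using k(2) c by (simp add: field_simps)
    also have "\<dots> = Re (vertex k / c * cnj g)"
      by simp
    finally have "0 \<le> Re ((vertex k / c - u m) * cnj g)"
      by (simp add: left_diff_distrib)
    then have "interaction n w (v(m := u m)) \<le> interaction n w (v(m := vertex k / c))"
      using interaction_update_diff[of n w m v "vertex k / c" "u m", OF sym diag] Suc.prems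
      unfolding g_def by auto
    moreover have "v(m := u m) = v" by (auto simp: v_def)
    moreover have "v(m := vertex k / c) =
        (\<lambda>i. if i < Suc m then vertex ((f(m := k)) i) / c else u i)"
      by (auto simp: v_def fun_eq_iff less_Suc_eq)
    ultimately show ?case
      using le f k(1) unfolding v_def[symmetric] by (intro exI[of _ "f(m := k)"]) auto
  qed
  obtain f where f: "\<And>i. f i < 8"
    and le: "interaction n w u \<le> interaction n w (\<lambda>i. if i < n then vertex (f i) / c else u i)"
    using step[of n] by auto
  note le
  \<comment> \<open>Each of the two arguments of the form carries a factor \<open>1 / c\<close>. The
    restriction only makes \<open>f\<close> extensional, as \<open>PiE\<close> requires.\<close>
  also have "interaction n w (\<lambda>i. if i < n then vertex (f i) / c else u i) =
      interaction n w (\<lambda>i. vertex (restrict f {..<n} i)) / c\<^sup>2"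
    unfolding interaction_def sum_divide_distrib
    by (intro sum.cong refl) (use c in \<open>simp add: power2_eq_square field_simps\<close>)
  finally have "c\<^sup>2 * interaction n w u \<le> interaction n w (\<lambda>i. vertex (restrict f {..<n} i))"
    using c by (simp add: field_simps)
  then show ?thesis
    using f unfolding c_def by (intro bexI[of _ "restrict f {..<n}"]) auto
qed

section \<open>Squared cosines by doubling angles\<close>

text \<open>With \<open>t\<close> the angle between \<open>a\<close> and \<open>b\<close>, this is
  the identity \<open>cos\<^sup>2 t = (1 + cos (2 t)) / 2\<close>.\<close>

lemma Re_mult_cnj_square:
  assumes "cmod a = 1" "cmod b = 1"
  shows "(Re (a * cnj b))\<^sup>2 = (1 + Re (a\<^sup>2 * cnj (b\<^sup>2))) / 2"
proof -
  define t where "t = a * cnj b"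
  have "(Re t)\<^sup>2 + (Im t)\<^sup>2 = 1"
    using assms cmod_power2[of t] by (simp add: t_def norm_mult)
  moreover have "Re (t\<^sup>2) = (Re t)\<^sup>2 - (Im t)\<^sup>2"
    by (simp add: power2_eq_square)
  moreover have "t\<^sup>2 = a\<^sup>2 * cnj (b\<^sup>2)"
    by (simp add: t_def power_mult_distrib)
  ultimately show ?thesis unfolding t_def[symmetric] by simp
qed

lemma sum_sum_Re_mult_cnj:
  "(\<Sum>i<n. \<Sum>j<n. Re (u i * cnj (u j))) = (cmod (\<Sum>i<(n::nat). u i))\<^sup>2"
proof -
  have "(\<Sum>i<n. \<Sum>j<n. Re (u i * cnj (u j))) = Re ((\<Sum>i<n. u i) * cnj (\<Sum>i<n. u i))"
    unfolding cnj_sum sum_product Re_sum ..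
  also have "(\<Sum>i<n. u i) * cnj (\<Sum>i<n. u i) = of_real ((cmod (\<Sum>i<n. u i))\<^sup>2)"
    by (rule complex_norm_square[symmetric])
  finally show ?thesis
    by (simp only: Re_complex_of_real)
qed

text \<open>Serves twice: it bounds the signal term from below by \<open>n\<^sup>2 / 2\<close>, and
  it evaluates the sum of squared coefficients in the Chernoff bound at a choice of
  vertices.\<close>

lemma sum_sum_Re_mult_cnj_square:
  assumes "\<And>i. i < n \<Longrightarrow> cmod (u i) = 1"
  shows "(\<Sum>i<n. \<Sum>j<n. (Re (u i * cnj (u j)))\<^sup>2) =
    (real n)\<^sup>2 / 2 + (cmod (\<Sum>i<n. (u i)\<^sup>2))\<^sup>2 / 2"
proof -
  have "(\<Sum>i<n. \<Sum>j<n. (Re (u i * cnj (u j)))\<^sup>2) =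
      (\<Sum>i<n. \<Sum>j<n. (1 + Re ((u i)\<^sup>2 * cnj ((u j)\<^sup>2))) / 2)"
    using assms by (intro sum.cong refl Re_mult_cnj_square) auto
  also have "\<dots> = (real n)\<^sup>2 / 2 + (\<Sum>i<n. \<Sum>j<n. Re ((u i)\<^sup>2 * cnj ((u j)\<^sup>2))) / 2"
    unfolding sum_divide_distrib[symmetric] sum.distrib by (simp add: power2_eq_square add_divide_distrib)
  finally show ?thesis unfolding sum_sum_Re_mult_cnj .
qed

section \<open>Exponential moments over all choices of vertices\<close>

text \<open>Squares of vertices are the powers of the imaginary unit. Turned by 45 degrees and
  scaled, these four points are the pairs of signs \<open>(s, t)\<close>, and each pair occurs for
  two of the eight \<open>k\<close>. Thus \<open>s\<close> and \<open>t\<close> behave like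
  independent random signs.\<close>

lemma sum_vertex_square:
  obtains s t :: "nat \<Rightarrow> int" where "\<And>k. \<bar>s k\<bar> = 1" "\<And>k. \<bar>t k\<bar> = 1"
    "\<And>k. k < 8 \<Longrightarrow> (vertex k)\<^sup>2 = Complex ((s k + t k) / 2) ((s k - t k) / 2)"
    "\<And>(x::real) (y::real). (\<Sum>k<8. exp (s k * x + t k * y)) = 8 * (cosh x * cosh y)"
proof
  define s t :: "nat \<Rightarrow> int"
    where "s k = (if k mod 4 < 2 then 1 else -1)" and "t k = (if k mod 4 = 0 \<or> k mod 4 = 3 then 1 else -1)" for k
  show "\<bar>s k\<bar> = 1" "\<bar>t k\<bar> = 1" for k by (auto simp: s_def t_def)
  show "(vertex k)\<^sup>2 = Complex ((s k + t k) / 2) ((s k - t k) / 2)" if "k < 8" for k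
  proof -
    have k: "k \<in> {0,1,2,3,4,5,6,7}" using that by auto
    have "(vertex k)\<^sup>2 = cis (real k * (pi / 2))"
      by (simp add: vertex_def Complex.DeMoivre field_simps)
    also have "\<dots> = \<i> ^ k"
      by (simp only: Complex.DeMoivre[symmetric] cis_pi_half)
    finally have "(vertex k)\<^sup>2 = \<i> ^ k" .
    moreover have "\<i> ^ 2 = -1" "\<i> ^ 3 = - \<i>" "\<i> ^ 4 = 1" "\<i> ^ 5 = \<i>" "\<i> ^ 6 = -1" "\<i> ^ 7 = - \<i>"
      by (simp_all add: numeral_eq_Suc)
    ultimately show ?thesis
      using k by (auto simp: s_def t_def complex_eq_iff)
  qed
  show "(\<Sum>k<8. exp (s k * x + t k * y)) = 8 * (cosh x * cosh y)" for x y :: real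
  proof -
    have eight: "{..<8::nat} = {0,1,2,3,4,5,6,7}" by auto
    have "(\<Sum>k<8. exp (s k * x + t k * y)) =
        2 * (exp x * exp y + exp x * exp (- y) + exp (- x) * exp y + exp (- x) * exp (- y))"
      unfolding eight by (simp add: s_def t_def mult_exp_exp)
    also have "\<dots> = 8 * (cosh x * cosh y)"
      unfolding cosh_field_def by (simp add: algebra_simps)
    finally show ?thesis .
  qed
qed

text \<open>Replacing the square of a sum by linear terms lets the sum over all choices of vertices
  factorise over the coordinates; the price is only polynomial in \<open>n\<close>.\<close>

lemma exp_square_le_sum_exp:
  fixes m :: int
  assumes "\<bar>m\<bar> \<le> int n"
  shows "exp (of_int m ^ 2 / (2 * real n)) \<le>
    (\<Sum>k = -int n..int n. exp (of_int k * of_int m / real n - of_int k ^ 2 / (2 * real n)))"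
proof -
  \<comment> \<open>The summand with \<open>k = m\<close> alone equals the left-hand side; the
    assumption puts it in the range of summation.\<close>
  have "exp (of_int m ^ 2 / (2 * real n)) = exp (of_int m * of_int m / real n - of_int m ^ 2 / (2 * real n))"
    by (simp add: power2_eq_square field_simps)
  also have "\<dots> \<le> (\<Sum>k = -int n..int n. exp (of_int k * of_int m / real n - of_int k ^ 2 / (2 * real n)))"
    using assms
    by (intro member_le_sum[of m _ "\<lambda>k. exp (of_int k * of_int m / real n - of_int k ^ 2 / (2 * real n))"]) auto
  finally show ?thesis .
qed

text \<open>Termwise comparison of the power series, resting on
  \<open>2 ^ n * fact n \<le> fact (2 * n)\<close>. It is the subgaussian bound for a random
  sign.\<close>

lemma cosh_le_exp_square: "cosh x \<le> exp (x\<^sup>2 / 2)" for x :: real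
proof (rule sums_le)
  have "(\<lambda>n. if even n then x ^ n /\<^sub>R fact n else 0) sums cosh x"
    by (rule cosh_converges)
  then show "(\<lambda>n. x ^ (2 * n) /\<^sub>R fact (2 * n)) sums cosh x"
    by (subst (asm) sums_mono_reindex[of "\<lambda>n. 2 * n", symmetric])
      (auto simp: strict_mono_def elim!: evenE)
  show "(\<lambda>n. (x\<^sup>2 / 2) ^ n /\<^sub>R fact n) sums exp (x\<^sup>2 / 2)"
    by (rule exp_converges)
  show "x ^ (2 * n) /\<^sub>R fact (2 * n) \<le> (x\<^sup>2 / 2) ^ n /\<^sub>R fact n" for n
  proof -
    have "2 ^ n * fact n \<le> (fact (2 * n) :: real)"
    proof (induction n)
      case (Suc n)
      have "2 ^ Suc n * fact (Suc n) = (2 * real n + 2) * (2 ^ n * fact n)"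
        by (simp add: algebra_simps)
      also have "\<dots> \<le> (2 * real n + 2) * ((2 * real n + 1) * fact (2 * n))"
      proof (intro mult_left_mono)
        have "2 ^ n * fact n \<le> 1 * (fact (2 * n) :: real)" using Suc by simp
        also have "\<dots> \<le> (2 * real n + 1) * fact (2 * n)" by (intro mult_right_mono) auto
        finally show "2 ^ n * fact n \<le> (2 * real n + 1) * fact (2 * n)" .
      qed auto
      also have "\<dots> = fact (2 * Suc n)"
        by (simp add: algebra_simps)
      finally show ?case .
    qed simp
    then have "x ^ (2 * n) / fact (2 * n) \<le> x ^ (2 * n) / (2 ^ n * fact n)"
      by (intro divide_left_mono) auto
    moreover have "(x\<^sup>2 / 2) ^ n / fact n = x ^ (2 * n) / (2 ^ n * fact n)"
      by (simp add: power_divide power_mult)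
    ultimately show ?thesis
      by (simp only: real_scaleR_def divide_inverse mult.commute)
  qed
qed

text \<open>The squared modulus splits into the squares of two sums of signs, and each is linearised
  at the cost of \<open>2 * n + 1\<close> terms. The factor \<open>1 / n\<close> in the exponent is
  borderline: for Gaussians of the same variance the expectation would be infinite, but here only a
  polynomial factor is lost.\<close>

lemma sum_exp_vertex_square_le:
  assumes "n > 0"
  shows "(\<Sum>f \<in> {..<n} \<rightarrow>\<^sub>E {..<8}. exp ((cmod (\<Sum>i<n. (vertex (f i))\<^sup>2))\<^sup>2 / n))
    \<le> (2 * real n + 1)\<^sup>2 * 8 ^ n"
proof -
  obtain s t :: "nat \<Rightarrow> int" where st: "\<And>k. \<bar>s k\<bar> = 1" "\<And>k. \<bar>t k\<bar> = 1"
    "\<And>k. k < 8 \<Longrightarrow> (vertex k)\<^sup>2 = Complex ((s k + t k) / 2) ((s k - t k) / 2)"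
    "\<And>(x::real) (y::real). (\<Sum>k<8. exp (s k * x + t k * y)) = 8 * (cosh x * cosh y)"
    using sum_vertex_square by blast
  let ?F = "{..<n} \<rightarrow>\<^sub>E {..<8::nat}" and ?K = "{-int n..int n}"
  define S T where "S f = (\<Sum>i<n. s (f i))" and "T f = (\<Sum>i<n. t (f i))" for f :: "nat \<Rightarrow> nat"
  have S: "\<bar>S f\<bar> \<le> int n" for f
    unfolding S_def by (rule order_trans[OF sum_abs]) (simp add: st)
  have T: "\<bar>T f\<bar> \<le> int n" for f
    unfolding T_def by (rule order_trans[OF sum_abs]) (simp add: st)
  have norm: "(cmod (\<Sum>i<n. (vertex (f i))\<^sup>2))\<^sup>2 = ((S f)\<^sup>2 + (T f)\<^sup>2) / 2" if "f \<in> ?F" for f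
  proof -
    have f: "f i < 8" if "i < n" for i
      using PiE_mem[OF \<open>f \<in> ?F\<close>, of i] that by simp
    have "(\<Sum>i<n. (vertex (f i))\<^sup>2) = (\<Sum>i<n. Complex ((s (f i) + t (f i)) / 2) ((s (f i) - t (f i)) / 2))"
      by (intro sum.cong refl st(3)) (auto simp: f)
    also have "\<dots> = Complex ((S f + T f) / 2) ((S f - T f) / 2)"
      by (simp add: complex_eq_iff Re_sum Im_sum S_def T_def sum.distrib sum_subtractf
          flip: sum_divide_distrib)
    finally have "(cmod (\<Sum>i<n. (vertex (f i))\<^sup>2))\<^sup>2 = ((S f + T f) / 2)\<^sup>2 + ((S f - T f) / 2)\<^sup>2"
      by (simp only: cmod_power2 complex.sel)
    then show ?thesis
      by (simp add: power2_eq_square field_simps)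
  qed
  define e where "e k m = exp (of_int k * of_int m / real n - of_int k ^ 2 / (2 * real n))" for k m :: int
  have e: "exp (of_int m ^ 2 / (2 * real n)) \<le> (\<Sum>k\<in>?K. e k m)" if "\<bar>m\<bar> \<le> int n" for m :: int
    unfolding e_def using that by (rule exp_square_le_sum_exp)
  have nonneg: "0 \<le> (\<Sum>k\<in>?K. e k m)" for m
    by (intro sum_nonneg) (simp add: e_def)
  have bound: "(\<Sum>f\<in>?F. e k (S f) * e l (T f)) \<le> 8 ^ n" for k l :: int
  proof -
    define x y where "x = of_int k / real n" and "y = of_int l / real n"
    have n: "of_int k ^ 2 / (2 * real n) = n * (x\<^sup>2 / 2)" "of_int l ^ 2 / (2 * real n) = n * (y\<^sup>2 / 2)"
      using assms by (simp_all add: x_def y_def power2_eq_square field_simps)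
    have prod: "e k (S f) * e l (T f) =
        exp (- n * (x\<^sup>2 / 2 + y\<^sup>2 / 2)) * (\<Prod>i<n. exp (s (f i) * x + t (f i) * y))" for f
    proof -
      have "(\<Prod>i<n. exp (s (f i) * x + t (f i) * y)) = exp (S f * x + T f * y)"
        by (simp add: S_def T_def sum.distrib sum_distrib_right flip: exp_sum)
      moreover have "e k (S f) * e l (T f) =
          exp (S f * x - n * (x\<^sup>2 / 2) + (T f * y - n * (y\<^sup>2 / 2)))"
        unfolding e_def n mult_exp_exp by (simp add: x_def y_def mult.commute)
      ultimately show ?thesis
        by (simp only: mult_exp_exp) (simp add: algebra_simps)
    qed
    \<comment> \<open>For fixed \<open>k\<close> and \<open>l\<close> the exponent is linear in the
      signs, so the sum over all \<open>f\<close> is a product of \<open>n\<close> equal sums over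
      eight vertices. The quadratic penalty in \<open>e\<close> then cancels the bound on
      \<open>cosh\<close> exactly.\<close>
    have "(\<Sum>f\<in>?F. \<Prod>i<n. exp (s (f i) * x + t (f i) * y)) = (8 * (cosh x * cosh y)) ^ n"
      unfolding st(4)[symmetric]
      using prod_sum_PiE[of "{..<n}" "\<lambda>_. {..<8::nat}" "\<lambda>_ j. exp (s j * x + t j * y)"]
      by simp
    also have "\<dots> \<le> (8 * (exp (x\<^sup>2 / 2) * exp (y\<^sup>2 / 2))) ^ n"
      by (intro power_mono mult_left_mono mult_mono cosh_le_exp_square) (simp_all add: cosh_real_nonneg)
    also have "\<dots> = 8 ^ n * exp (n * (x\<^sup>2 / 2 + y\<^sup>2 / 2))"
      by (simp only: mult_exp_exp exp_of_nat_mult power_mult_distrib)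
    finally have "(\<Sum>f\<in>?F. e k (S f) * e l (T f)) \<le>
        exp (- n * (x\<^sup>2 / 2 + y\<^sup>2 / 2)) * (8 ^ n * exp (n * (x\<^sup>2 / 2 + y\<^sup>2 / 2)))"
      unfolding prod sum_distrib_left[symmetric] by (intro mult_left_mono) auto
    also have "\<dots> = 8 ^ n * exp (- n * (x\<^sup>2 / 2 + y\<^sup>2 / 2) + n * (x\<^sup>2 / 2 + y\<^sup>2 / 2))"
      by (simp only: exp_add mult_ac)
    finally show ?thesis by simp
  qed
  have "(\<Sum>f\<in>?F. exp ((cmod (\<Sum>i<n. (vertex (f i))\<^sup>2))\<^sup>2 / n)) =
      (\<Sum>f\<in>?F. exp (of_int (S f) ^ 2 / (2 * real n)) * exp (of_int (T f) ^ 2 / (2 * real n)))"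
  proof (intro sum.cong refl)
    fix f assume f: "f \<in> ?F"
    have "(of_int (S f) ^ 2 + of_int (T f) ^ 2) / 2 / n =
        of_int (S f) ^ 2 / (2 * real n) + of_int (T f) ^ 2 / (2 * real n)"
      by (simp add: add_divide_distrib)
    then show "exp ((cmod (\<Sum>i<n. (vertex (f i))\<^sup>2))\<^sup>2 / n) =
        exp (of_int (S f) ^ 2 / (2 * real n)) * exp (of_int (T f) ^ 2 / (2 * real n))"
      by (simp only: norm[OF f] mult_exp_exp of_int_add of_int_power of_int_numeral)
  qed
  also have "\<dots> \<le> (\<Sum>f\<in>?F. (\<Sum>k\<in>?K. e k (S f)) * (\<Sum>l\<in>?K. e l (T f)))"
    by (intro sum_mono mult_mono e S T nonneg) auto
  also have "\<dots> = (\<Sum>k\<in>?K. \<Sum>l\<in>?K. \<Sum>f\<in>?F. e k (S f) * e l (T f))"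
    unfolding sum_product by (subst sum.swap, rule sum.cong[OF refl], rule sum.swap)
  also have "\<dots> \<le> (\<Sum>k\<in>?K. \<Sum>l\<in>?K. 8 ^ n)"
    by (intro sum_mono bound)
  also have "\<dots> = (2 * real n + 1)\<^sup>2 * 8 ^ n"
    by (simp add: power2_eq_square algebra_simps)
  finally show ?thesis .
qed

section \<open>Chernoff bound for the Gaussian noise\<close>

text \<open>Completing the square turns the integrand into a multiple of the normal density with
  mean \<open>c\<close>. The nonnegative integral spares integrability conditions.\<close>

lemma nn_integral_exp_std_normal:
  assumes "distributed M lborel X std_normal_density"
  shows "(\<integral>\<^sup>+\<omega>. ennreal (exp (c * X \<omega>)) \<partial>M) = ennreal (exp (c\<^sup>2 / 2))"
proof -
  have eq: "exp (c * x) * std_normal_density x = exp (c\<^sup>2 / 2) * normal_density c 1 x" for x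
  proof -
    have "c * x + - x\<^sup>2 / 2 = c\<^sup>2 / 2 + - (x - c)\<^sup>2 / 2"
      by (simp add: power2_eq_square field_simps)
    then have "exp (c * x) * exp (- x\<^sup>2 / 2) = exp (c\<^sup>2 / 2) * exp (- (x - c)\<^sup>2 / 2)"
      by (simp only: mult_exp_exp)
    then show ?thesis
      by (simp add: normal_density_def)
  qed
  have "(\<integral>\<^sup>+\<omega>. ennreal (exp (c * X \<omega>)) \<partial>M) =
      (\<integral>\<^sup>+x. ennreal (std_normal_density x) * ennreal (exp (c * x)) \<partial>lborel)"
    by (rule distributed_nn_integral[OF assms, symmetric]) measurable
  also have "\<dots> = (\<integral>\<^sup>+x. ennreal (exp (c\<^sup>2 / 2)) * ennreal (normal_density c 1 x) \<partial>lborel)"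
  proof (rule nn_integral_cong)
    fix x
    show "ennreal (std_normal_density x) * ennreal (exp (c * x)) =
        ennreal (exp (c\<^sup>2 / 2)) * ennreal (normal_density c 1 x)"
      using arg_cong[OF eq[of x], of ennreal] by (simp add: ennreal_mult mult.commute)
  qed
  also have "\<dots> = ennreal (exp (c\<^sup>2 / 2)) * (\<integral>\<^sup>+x. ennreal (normal_density c 1 x) \<partial>lborel)"
    by (rule nn_integral_cmult) simp
  also have "(\<integral>\<^sup>+x. ennreal (normal_density c 1 x) \<partial>lborel) = 1"
    by (subst nn_integral_eq_integral) auto
  finally show ?thesis by simp
qed

text \<open>Passes to the strict lower triangle, the index set on which the noise entries are
  independent.\<close>

lemma sum_symmetric_eq:
  fixes g :: "nat \<Rightarrow> nat \<Rightarrow> real"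
  assumes "\<And>i j. i < n \<Longrightarrow> j < n \<Longrightarrow> g i j = g j i"
  shows "(\<Sum>i<n. \<Sum>j<n. g i j) = 2 * (\<Sum>(i, j)\<in>{(i, j). j < i \<and> i < n}. g i j) + (\<Sum>i<n. g i i)"
proof -
  let ?L = "{(i, j). j < i \<and> i < n}" and ?U = "{(i, j). i < j \<and> j < n}" and ?D = "(\<lambda>i. (i, i)) ` {..<n}"
  have fin: "finite ?L" "finite ?U" "finite ?D"
    by (auto intro: finite_subset[of _ "{..<n} \<times> {..<n}"])
  have "(\<Sum>i<n. \<Sum>j<n. g i j) = (\<Sum>(i, j)\<in>{..<n} \<times> {..<n}. g i j)"
    by (rule sum.cartesian_product)
  also have "{..<n} \<times> {..<n} = (?L \<union> ?U) \<union> ?D"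
    by auto
  also have "(\<Sum>(i, j)\<in>(?L \<union> ?U) \<union> ?D. g i j) =
      (\<Sum>(i, j)\<in>?L. g i j) + (\<Sum>(i, j)\<in>?U. g i j) + (\<Sum>(i, j)\<in>?D. g i j)"
    using fin by (subst sum.union_disjoint; (subst sum.union_disjoint)?) auto
  also have "(\<Sum>(i, j)\<in>?U. g i j) = (\<Sum>(i, j)\<in>?L. g i j)"
    by (rule sum.reindex_bij_witness[of _ prod.swap prod.swap]) (auto simp: assms)
  also have "(\<Sum>(i, j)\<in>?D. g i j) = (\<Sum>i<n. g i i)"
    by (subst sum.reindex) (auto simp: inj_on_def)
  finally show ?thesis by simp
qed

lemma gaussian_noise_sym:
  assumes "gaussian_noise M n W" "\<omega> \<in> space M" "i < n" "j < n"
  shows "W \<omega> $$ (i, j) = W \<omega> $$ (j, i)"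
proof -
  have W: "W \<omega> \<in> carrier_mat n n" "(W \<omega>)\<^sup>T = W \<omega>"
    using assms by (auto simp: gaussian_noise_def)
  have "(W \<omega>)\<^sup>T $$ (i, j) = W \<omega> $$ (j, i)"
    using W(1) assms by auto
  then show ?thesis unfolding W(2) .
qed

lemma gaussian_noise_diag:
  assumes "gaussian_noise M n W" "\<omega> \<in> space M" "i < n"
  shows "W \<omega> $$ (i, i) = 0"
  using assms by (auto simp: gaussian_noise_def)

text \<open>Distributions are given only below the diagonal; symmetry and the zero diagonal, valid
  on \<open>space M\<close>, reach the other entries.\<close>

lemma gaussian_noise_entry_measurable:
  assumes W: "gaussian_noise M n W" and "i < n" "j < n"
  shows "(\<lambda>\<omega>. W \<omega> $$ (i, j)) \<in> borel_measurable M"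
proof -
  have off: "(\<lambda>\<omega>. W \<omega> $$ (i, j)) \<in> borel_measurable M" if "j < i" "i < n" for i j
  proof -
    have "distributed M lborel (\<lambda>\<omega>. W \<omega> $$ (i, j)) std_normal_density"
      using W that by (simp add: gaussian_noise_def)
    from distributed_measurable[OF this] show ?thesis by simp
  qed
  consider "j < i" | "i < j" | "i = j" by linarith
  then show ?thesis
  proof cases
    case 2
    then have "(\<lambda>\<omega>. W \<omega> $$ (j, i)) \<in> borel_measurable M" using off assms by simp
    then show ?thesis using gaussian_noise_sym[OF W] assms
      by (subst measurable_cong[of M _ "\<lambda>\<omega>. W \<omega> $$ (j, i)"]) auto
  next
    case 3
    then show ?thesis using gaussian_noise_diag[OF W] assms by (subst measurable_cong[of M _ "\<lambda>_. 0"]) auto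
  qed (use off assms in auto)
qed

text \<open>Each independent entry occurs twice in the symmetric sum, hence with coefficient
  \<open>2 * b i j\<close>. The parameter \<open>\<beta>\<close> stays free, so that one value can
  be used for all choices of vertices.\<close>

lemma gaussian_noise_chernoff:
  fixes b :: "nat \<Rightarrow> nat \<Rightarrow> real"
  assumes W: "gaussian_noise M n W"
    and b: "\<And>i j. i < n \<Longrightarrow> j < n \<Longrightarrow> b i j = b j i" and "\<beta> > 0"
  shows "measure M {\<omega> \<in> space M. (\<Sum>i<n. \<Sum>j<n. W \<omega> $$ (i, j) * b i j) \<ge> t}
    \<le> exp (\<beta>\<^sup>2 * (\<Sum>i<n. \<Sum>j<n. (b i j)\<^sup>2) - \<beta> * t)"
proof -
  interpret prob_space M using W by (simp add: gaussian_noise_def)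
  let ?L = "{(i, j). j < i \<and> i < n}"
  define F where "F \<omega> = (\<Sum>i<n. \<Sum>j<n. W \<omega> $$ (i, j) * b i j)" for \<omega>
  have fin: "finite ?L"
    by (rule finite_subset[of _ "{..<n} \<times> {..<n}"]) auto
  have meas [measurable]: "F \<in> borel_measurable M"
    unfolding F_def
    by (intro borel_measurable_sum borel_measurable_times gaussian_noise_entry_measurable[OF W]) auto
  have F: "F \<omega> = 2 * (\<Sum>(i, j)\<in>?L. W \<omega> $$ (i, j) * b i j)" if "\<omega> \<in> space M" for \<omega>
  proof -
    have "F \<omega> = 2 * (\<Sum>(i, j)\<in>?L. W \<omega> $$ (i, j) * b i j) + (\<Sum>i<n. W \<omega> $$ (i, i) * b i i)"
      unfolding F_def by (intro sum_symmetric_eq) (simp add: b gaussian_noise_sym[OF W that])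
    then show ?thesis by (simp add: gaussian_noise_diag[OF W that])
  qed
  have indep: "indep_vars (\<lambda>_. borel) (\<lambda>p \<omega>. ennreal (exp (2 * \<beta> * b (fst p) (snd p) * W \<omega> $$ p))) ?L"
  proof -
    have "indep_vars (\<lambda>_. borel) (\<lambda>p \<omega>. W \<omega> $$ p) ?L"
      using W by (simp add: gaussian_noise_def split_def)
    then show ?thesis
      by (rule indep_vars_compose2) auto
  qed
  have "(\<integral>\<^sup>+\<omega>. ennreal (exp (\<beta> * F \<omega>)) \<partial>M) =
      (\<integral>\<^sup>+\<omega>. (\<Prod>p\<in>?L. ennreal (exp (2 * \<beta> * b (fst p) (snd p) * W \<omega> $$ p))) \<partial>M)"
  proof (rule nn_integral_cong)
    fix \<omega> assume "\<omega> \<in> space M"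
    then have "\<beta> * F \<omega> = (\<Sum>p\<in>?L. 2 * \<beta> * b (fst p) (snd p) * W \<omega> $$ p)"
      by (simp add: F sum_distrib_left split_def mult_ac)
    then show "ennreal (exp (\<beta> * F \<omega>)) = (\<Prod>p\<in>?L. ennreal (exp (2 * \<beta> * b (fst p) (snd p) * W \<omega> $$ p)))"
      using fin by (simp add: prod_ennreal exp_sum)
  qed
  also have "\<dots> = (\<Prod>p\<in>?L. \<integral>\<^sup>+\<omega>. ennreal (exp (2 * \<beta> * b (fst p) (snd p) * W \<omega> $$ p)) \<partial>M)"
    by (rule indep_vars_nn_integral[OF fin indep]) auto
  also have "\<dots> = (\<Prod>p\<in>?L. ennreal (exp ((2 * \<beta> * b (fst p) (snd p))\<^sup>2 / 2)))"
    using W by (intro prod.cong refl nn_integral_exp_std_normal) (auto simp: gaussian_noise_def)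
  also have "\<dots> = ennreal (exp (\<beta>\<^sup>2 * (2 * (\<Sum>(i, j)\<in>?L. (b i j)\<^sup>2))))"
    using fin by (simp add: prod_ennreal exp_sum sum_distrib_left split_def power_mult_distrib mult_ac)
  \<comment> \<open>The squares on the diagonal are added, to obtain a plain double sum.\<close>
  also have "\<dots> \<le> ennreal (exp (\<beta>\<^sup>2 * (\<Sum>i<n. \<Sum>j<n. (b i j)\<^sup>2)))"
    using b by (subst sum_symmetric_eq) (auto intro!: ennreal_leI mult_left_mono sum_nonneg)
  finally have mgf: "(\<integral>\<^sup>+\<omega>. ennreal (exp (\<beta> * F \<omega>)) \<partial>M) \<le> ennreal (exp (\<beta>\<^sup>2 * (\<Sum>i<n. \<Sum>j<n. (b i j)\<^sup>2)))" .
  have "emeasure M {\<omega> \<in> space M. t \<le> F \<omega>} \<le>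
      ennreal (exp (- \<beta> * t)) * (\<integral>\<^sup>+\<omega>. ennreal (exp (\<beta> * F \<omega>)) * indicator (space M) \<omega> \<partial>M)"
    using \<open>\<beta> > 0\<close> by (intro Chernoff_ineq_nn_integral_ge) auto
  also have "\<dots> = ennreal (exp (- \<beta> * t)) * (\<integral>\<^sup>+\<omega>. ennreal (exp (\<beta> * F \<omega>)) \<partial>M)"
    by (intro arg_cong2[where f="(*)"] nn_integral_cong refl) simp
  also have "\<dots> \<le> ennreal (exp (- \<beta> * t)) * ennreal (exp (\<beta>\<^sup>2 * (\<Sum>i<n. \<Sum>j<n. (b i j)\<^sup>2)))"
    by (intro mult_left_mono mgf) simp
  also have "\<dots> = ennreal (exp (\<beta>\<^sup>2 * (\<Sum>i<n. \<Sum>j<n. (b i j)\<^sup>2) - \<beta> * t))"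
    by (simp flip: ennreal_mult add: mult_exp_exp)
  finally show ?thesis
    unfolding F_def[symmetric] by (simp add: emeasure_eq_measure)
qed

section \<open>Second-order critical points\<close>

definition row_complex :: "real mat \<Rightarrow> nat \<Rightarrow> complex" where
  "row_complex Q i = Complex (Q $$ (i, 0)) (Q $$ (i, 1))"

lemma gram_entry:
  assumes "Q \<in> carrier_mat n 2" "i < n" "j < n"
  shows "(Q * Q\<^sup>T) $$ (i, j) = Re (row_complex Q i * cnj (row_complex Q j))"
  using assms by (simp add: scalar_prod_def row_complex_def numeral_2_eq_2)

lemma norm2_row:
  assumes "Q \<in> carrier_mat n 2" "i < n"
  shows "norm2 (row Q i) = cmod (row_complex Q i)"
  using assms by (simp add: norm2_def L2_set_def row_complex_def cmod_def numeral_2_eq_2)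

lemma norm2_transpose_mult_vec:
  assumes "Q \<in> carrier_mat n 2" "z \<in> carrier_vec n"
  shows "norm2 (Q\<^sup>T *\<^sub>v z) = cmod (\<Sum>i<n. z $ i * row_complex Q i)"
  using assms
  by (simp add: norm2_def L2_set_def row_complex_def cmod_def numeral_2_eq_2 scalar_prod_def
      Re_sum Im_sum atLeast0LessThan mult.commute)

text \<open>The matrix is the Laplacian of the weights \<open>A $$ (i, j)\<close> times Gram entry:
  its diagonal part holds the row sums of the weights, from which the weights themselves are
  subtracted.\<close>

lemma hessian_quadratic_form:
  assumes A: "A \<in> carrier_mat n n" and Q: "Q \<in> carrier_mat n 2" and v: "v \<in> carrier_vec n"
  shows "v \<bullet> ((ddiag (A * Q * Q\<^sup>T) - hadamard A (Q * Q\<^sup>T)) *\<^sub>v v) =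
    (\<Sum>i<n. \<Sum>j<n. A $$ (i, j) * Re (row_complex Q i * cnj (row_complex Q j)) * ((v $ i)\<^sup>2 - v $ i * v $ j))"
proof -
  let ?c = "\<lambda>i j. Re (row_complex Q i * cnj (row_complex Q j))"
  let ?H = "ddiag (A * Q * Q\<^sup>T) - hadamard A (Q * Q\<^sup>T)"
  have diag: "(A * Q * Q\<^sup>T) $$ (i, i) = (\<Sum>j<n. A $$ (i, j) * ?c i j)" if "i < n" for i
  proof -
    have "A * Q * Q\<^sup>T = A * (Q * Q\<^sup>T)"
      using A Q by (intro assoc_mult_mat) auto
    then have "(A * Q * Q\<^sup>T) $$ (i, i) = (\<Sum>j<n. A $$ (i, j) * (Q * Q\<^sup>T) $$ (j, i))"
      using A Q that by (simp add: scalar_prod_def atLeast0LessThan)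
    also have "\<dots> = (\<Sum>j<n. A $$ (i, j) * ?c i j)"
      using Q that by (intro sum.cong refl) (simp only: gram_entry lessThan_iff Re_mult_cnj_commute)
    finally show ?thesis .
  qed
  have entry: "?H $$ (i, j) = (if i = j then \<Sum>k<n. A $$ (i, k) * ?c i k else 0) - A $$ (i, j) * ?c i j"
    if "i < n" "j < n" for i j
    using A Q that diag gram_entry[OF Q that]
    by (simp add: ddiag_def hadamard_def mat_diag_def del: index_mult_mat(1) times_complex.sel)
  have "v \<bullet> (?H *\<^sub>v v) = (\<Sum>i<n. v $ i * (\<Sum>j<n. ?H $$ (i, j) * v $ j))"
    using A Q v
    by (simp add: scalar_prod_def atLeast0LessThan ddiag_def hadamard_def mat_diag_def
        del: index_mult_mat(1) index_minus_mat(1))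
  also have "\<dots> = (\<Sum>i<n. v $ i * ((\<Sum>k<n. A $$ (i, k) * ?c i k) * v $ i - (\<Sum>j<n. A $$ (i, j) * ?c i j * v $ j)))"
    by (intro sum.cong refl arg_cong2[where f="(*)"])
      (simp add: entry left_diff_distrib sum_subtractf if_distrib[of "\<lambda>x. x * _"] sum.delta'
        cong: if_cong del: times_complex.sel)
  also have "\<dots> = (\<Sum>i<n. \<Sum>j<n. A $$ (i, j) * ?c i j * ((v $ i)\<^sup>2 - v $ i * v $ j))"
    by (intro sum.cong refl)
      (simp add: sum_distrib_left sum_distrib_right sum_subtractf right_diff_distrib power2_eq_square mult_ac
        del: times_complex.sel)
  finally show ?thesis .
qed

text \<open>The second-order condition is averaged over the two directions that rotate every row
  \<open>z i * u i\<close> along the component of a fixed vector tangent to the circle.\<close>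

lemma second_order_critical_imp_le:
  assumes A: "A \<in> carrier_mat n n" and crit: "second_order_critical n A Q" and z: "sign_vec n z"
  defines "u \<equiv> row_complex Q"
  shows "(\<Sum>i<n. \<Sum>j<n. A $$ (i, j) * (z $ i * z $ j) * (Re (u i * cnj (u j)))\<^sup>2)
    \<le> (\<Sum>i<n. \<Sum>j<n. A $$ (i, j) * Re (u i * cnj (u j)))"
proof -
  have Q: "Q \<in> carrier_mat n 2" and unit: "\<And>i. i < n \<Longrightarrow> cmod (u i) = 1"
    using crit norm2_row unfolding u_def by (auto simp: second_order_critical_def feasible_def)
  have zz: "z $ i * z $ i = 1" if "i < n" for i
    using z that by (auto simp: sign_vec_def)
  have psd: "0 \<le> v \<bullet> ((ddiag (A * Q * Q\<^sup>T) - hadamard A (Q * Q\<^sup>T)) *\<^sub>v v)" if "v \<in> carrier_vec n" for v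
    using crit that by (auto simp: second_order_critical_def pos_semidef_def)
  define a b where "a = vec n (\<lambda>i. z $ i * Re (u i))" and "b = vec n (\<lambda>i. z $ i * Im (u i))"
  have sum: "((a $ i)\<^sup>2 - a $ i * a $ j) + ((b $ i)\<^sup>2 - b $ i * b $ j) = 1 - (z $ i * z $ j) * Re (u i * cnj (u j))"
    if "i < n" "j < n" for i j
  proof -
    have "(a $ i)\<^sup>2 + (b $ i)\<^sup>2 = (z $ i * z $ i) * (cmod (u i))\<^sup>2"
      unfolding cmod_power2 using that by (simp add: a_def b_def power2_eq_square algebra_simps)
    then have "(a $ i)\<^sup>2 + (b $ i)\<^sup>2 = 1"
      using that zz unit by simp
    moreover have "a $ i * a $ j + b $ i * b $ j = (z $ i * z $ j) * Re (u i * cnj (u j))"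
      using that by (simp add: a_def b_def algebra_simps)
    ultimately show ?thesis by linarith
  qed
  have "0 \<le> (\<Sum>i<n. \<Sum>j<n. A $$ (i, j) * Re (u i * cnj (u j)) * ((a $ i)\<^sup>2 - a $ i * a $ j))
      + (\<Sum>i<n. \<Sum>j<n. A $$ (i, j) * Re (u i * cnj (u j)) * ((b $ i)\<^sup>2 - b $ i * b $ j))"
    using psd[of a] psd[of b] hessian_quadratic_form[OF A Q, of a] hessian_quadratic_form[OF A Q, of b]
    unfolding u_def by (simp add: a_def b_def del: times_complex.sel)
  also have "\<dots> = (\<Sum>i<n. \<Sum>j<n. A $$ (i, j) * Re (u i * cnj (u j)) -
      A $$ (i, j) * (z $ i * z $ j) * (Re (u i * cnj (u j)))\<^sup>2)"
    unfolding sum.distrib[symmetric] distrib_left[symmetric]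
    by (intro sum.cong refl)
      (simp only: lessThan_iff sum, simp add: right_diff_distrib power2_eq_square mult_ac del: times_complex.sel)
  finally show ?thesis
    by (simp add: sum_subtractf del: times_complex.sel)
qed

section \<open>From noise bounds to correlation with the signal\<close>

lemma interaction_uminus: "interaction n (\<lambda>i j. - w i j) u = - interaction n w u"
  by (simp add: interaction_def sum_negf del: times_complex.sel)

lemma sqrt_2_ge: "14142 / 10000 \<le> sqrt 2"
  by (rule real_le_rsqrt) (simp add: power2_eq_square)

lemma cos_pi_eighth_squared: "(cos (pi / 8))\<^sup>2 \<ge> 8535 / 10000"
proof -
  have "cos (2 * (pi / 8)) = 2 * (cos (pi / 8))\<^sup>2 - 1"
    by (rule cos_double_cos)
  then have "sqrt 2 / 2 = 2 * (cos (pi / 8))\<^sup>2 - 1"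
    by (simp add: cos_45)
  then show ?thesis using sqrt_2_ge by linarith
qed

text \<open>The octagon bound is applied to \<open>w\<close> and to \<open>- w\<close>. The new
  constant comes from \<open>2.25 / 0.8535 < 2.6363\<close>, where \<open>0.8535\<close> is a lower
  bound for \<open>cos\<^sup>2 (pi / 8)\<close>.\<close>

lemma abs_interaction_le:
  assumes sym: "\<And>i j. i < n \<Longrightarrow> j < n \<Longrightarrow> w i j = w j i"
    and diag: "\<And>i. i < n \<Longrightarrow> w i i = 0"
    and vert: "\<And>f. f \<in> {..<n} \<rightarrow>\<^sub>E {..<8} \<Longrightarrow> \<bar>interaction n w (\<lambda>i. vertex (f i))\<bar> \<le> 9 / 4 * t"
    and u: "\<And>i. i < n \<Longrightarrow> cmod (u i) \<le> 1"
  shows "\<bar>interaction n w u\<bar> \<le> 26363 / 10000 * t"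
proof -
  let ?\<kappa> = "(cos (pi / 8))\<^sup>2"
  obtain f where f: "f \<in> {..<n} \<rightarrow>\<^sub>E {..<8}"
    "?\<kappa> * interaction n w u \<le> interaction n w (\<lambda>i. vertex (f i))"
    using interaction_le_vertices[of n w u, OF sym diag u] by blast
  have "\<exists>g \<in> {..<n} \<rightarrow>\<^sub>E {..<8}. ?\<kappa> * interaction n (\<lambda>i j. - w i j) u \<le>
      interaction n (\<lambda>i j. - w i j) (\<lambda>i. vertex (g i))"
    by (rule interaction_le_vertices) (simp_all add: sym diag u)
  then obtain g where g: "g \<in> {..<n} \<rightarrow>\<^sub>E {..<8}"
    "?\<kappa> * - interaction n w u \<le> - interaction n w (\<lambda>i. vertex (g i))"
    unfolding interaction_uminus by blast
  have "?\<kappa> * interaction n w u \<le> 9 / 4 * t"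
    using f(2) vert[OF f(1)] by linarith
  moreover have "?\<kappa> * - interaction n w u \<le> 9 / 4 * t"
    using g(2) vert[OF g(1)] by linarith
  ultimately have "?\<kappa> * \<bar>interaction n w u\<bar> \<le> 9 / 4 * t"
    by (simp add: abs_if)
  moreover have "8535 / 10000 * \<bar>interaction n w u\<bar> \<le> ?\<kappa> * \<bar>interaction n w u\<bar>"
    by (intro mult_right_mono cos_pi_eighth_squared) auto
  ultimately show ?thesis by linarith
qed

lemma sign_vec_mult_self:
  assumes "sign_vec n z" "i < n" "j < n"
  shows "(z $ i * z $ j) * (z $ i * z $ j) = 1"
proof -
  have "z $ k * z $ k = 1" if "k < n" for k
    using assms that by (auto simp: sign_vec_def)
  moreover have "(z $ i * z $ j) * (z $ i * z $ j) = (z $ i * z $ i) * (z $ j * z $ j)"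
    by (simp only: mult_ac)
  ultimately show ?thesis using assms by simp
qed

text \<open>The deterministic half of the argument: finitely many noise bounds, at the vertices and
  along \<open>z\<close>, control every critical point at once.\<close>

lemma second_order_critical_correlation:
  assumes lam: "lam > 8" and z: "sign_vec n z"
    and W: "W \<in> carrier_mat n n"
    and sym: "\<And>i j. i < n \<Longrightarrow> j < n \<Longrightarrow> W $$ (i, j) = W $$ (j, i)"
    and diag: "\<And>i. i < n \<Longrightarrow> W $$ (i, i) = 0"
    and vert: "\<And>f. f \<in> {..<n} \<rightarrow>\<^sub>E {..<8} \<Longrightarrow>
      \<bar>interaction n (\<lambda>i j. W $$ (i, j)) (\<lambda>i. vertex (f i))\<bar> \<le> 9 / 4 * (n * sqrt n)"
    and signal: "(\<Sum>i<n. \<Sum>j<n. W $$ (i, j) * - (z $ i * z $ j)) \<le> n * sqrt n / 20"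
    and crit: "second_order_critical n (observation (sqrt n / lam) z W) Q"
  shows "norm2 (Q\<^sup>T *\<^sub>v z) \<ge> n / 20"
proof -
  define u where "u = row_complex Q"
  define \<sigma> where "\<sigma> = sqrt n / lam"
  define N where "N = norm2 (Q\<^sup>T *\<^sub>v z)"
  define w where "w = (\<lambda>i j. W $$ (i, j))"
  have w_sym: "w i j = w j i" if "i < n" "j < n" for i j
    unfolding w_def using that by (rule sym)
  have w_diag: "w i i = 0" if "i < n" for i
    unfolding w_def using that by (rule diag)
  have w_vert: "\<bar>interaction n w (\<lambda>i. vertex (f i))\<bar> \<le> 9 / 4 * (n * sqrt n)"
    if "f \<in> {..<n} \<rightarrow>\<^sub>E {..<8}" for f
    unfolding w_def using that by (rule vert)
  let ?A = "observation \<sigma> z W"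
  let ?c = "\<lambda>i j. Re (u i * cnj (u j))"
  have Q: "Q \<in> carrier_mat n 2" and unit: "\<And>i. i < n \<Longrightarrow> cmod (u i) = 1"
    using crit norm2_row unfolding u_def by (auto simp: second_order_critical_def feasible_def)
  have zc: "z \<in> carrier_vec n" and zabs: "\<And>i. i < n \<Longrightarrow> \<bar>z $ i\<bar> = 1"
    using z by (auto simp: sign_vec_def)
  have A: "?A \<in> carrier_mat n n"
    using zc W by (simp add: observation_def outer_square_def)
  have entry: "?A $$ (i, j) = z $ i * z $ j + \<sigma> * w i j" if "i < n" "j < n" for i j
    using zc W that by (simp add: observation_def outer_square_def w_def)
  have N: "(\<Sum>i<n. \<Sum>j<n. (z $ i * z $ j) * ?c i j) = N\<^sup>2"
    unfolding N_def norm2_transpose_mult_vec[OF Q zc] u_def sum_sum_Re_mult_cnj[symmetric]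
    by (intro sum.cong refl) (simp add: algebra_simps)
  \<comment> \<open>The signs are absorbed into \<open>z $ i * (u i)\<^sup>2\<close>, again of
    modulus 1, so the same noise bound covers the doubled angles.\<close>
  have u2: "(z $ i * z $ j) * (?c i j)\<^sup>2 =
      ((z $ i * z $ j) + Re ((z $ i * (u i)\<^sup>2) * cnj (z $ j * (u j)\<^sup>2))) / 2" if "i < n" "j < n" for i j
    unfolding Re_mult_cnj_square[OF unit[OF that(1)] unit[OF that(2)]]
    by (simp add: power2_eq_square algebra_simps)
  have "(\<Sum>i<n. \<Sum>j<n. ?A $$ (i, j) * ?c i j) = N\<^sup>2 + \<sigma> * interaction n w u"
    unfolding N[symmetric] interaction_def sum_distrib_left sum.distrib[symmetric]
    by (intro sum.cong refl) (simp only: lessThan_iff entry, simp add: algebra_simps del: times_complex.sel)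
  moreover have "(\<Sum>i<n. \<Sum>j<n. ?A $$ (i, j) * (z $ i * z $ j) * (?c i j)\<^sup>2) =
      (\<Sum>i<n. \<Sum>j<n. (?c i j)\<^sup>2) + \<sigma> * ((\<Sum>i<n. \<Sum>j<n. w i j * (z $ i * z $ j)) / 2
        + interaction n w (\<lambda>i. z $ i * (u i)\<^sup>2) / 2)"
  proof -
    have eq: "?A $$ (i, j) * (z $ i * z $ j) * (?c i j)\<^sup>2 = (?c i j)\<^sup>2 + \<sigma> * (w i j * (z $ i * z $ j) / 2
        + w i j * Re ((z $ i * (u i)\<^sup>2) * cnj (z $ j * (u j)\<^sup>2)) / 2)" if "i < n" "j < n" for i j
    proof -
      have "?A $$ (i, j) * (z $ i * z $ j) * (?c i j)\<^sup>2 =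
          ((z $ i * z $ j) * (z $ i * z $ j)) * (?c i j)\<^sup>2 + \<sigma> * w i j * ((z $ i * z $ j) * (?c i j)\<^sup>2)"
        unfolding entry[OF that] by (simp add: algebra_simps del: times_complex.sel)
      also have "\<dots> = (?c i j)\<^sup>2 + \<sigma> * w i j * (((z $ i * z $ j) +
          Re ((z $ i * (u i)\<^sup>2) * cnj (z $ j * (u j)\<^sup>2))) / 2)"
        by (simp only: sign_vec_mult_self[OF z that] u2[OF that] mult_1)
      finally show ?thesis
        by (simp only: distrib_left add_divide_distrib times_divide_eq_right mult_1 mult.assoc)
    qed
    show ?thesis
      unfolding interaction_def sum_distrib_left sum_divide_distrib sum.distrib[symmetric]
      by (intro sum.cong refl) (simp only: lessThan_iff eq)
  qed
  ultimately have "(\<Sum>i<n. \<Sum>j<n. (?c i j)\<^sup>2) + \<sigma> * ((\<Sum>i<n. \<Sum>j<n. w i j * (z $ i * z $ j)) / 2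
        + interaction n w (\<lambda>i. z $ i * (u i)\<^sup>2) / 2) \<le> N\<^sup>2 + \<sigma> * interaction n w u"
    using second_order_critical_imp_le[OF A crit[folded \<sigma>_def] z] unfolding u_def by simp
  moreover have "(real n)\<^sup>2 / 2 \<le> (\<Sum>i<n. \<Sum>j<n. (?c i j)\<^sup>2)"
    using sum_sum_Re_mult_cnj_square[of n u, OF unit] by simp
  ultimately have "(real n)\<^sup>2 / 2 \<le> N\<^sup>2 + \<sigma> * (interaction n w u -
      (\<Sum>i<n. \<Sum>j<n. w i j * (z $ i * z $ j)) / 2 - interaction n w (\<lambda>i. z $ i * (u i)\<^sup>2) / 2)"
    by (simp add: algebra_simps)
  \<comment> \<open>The numbers are \<open>2.6363 * 3 / 2 + 1 / 40 = 3.97945 < 3.98\<close>.\<close>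
  also have "\<dots> \<le> N\<^sup>2 + \<sigma> * (398 / 100 * (n * sqrt n))"
  proof -
    have "\<bar>interaction n w u\<bar> \<le> 26363 / 10000 * (n * sqrt n)"
      by (rule abs_interaction_le[OF w_sym w_diag w_vert]) (simp_all add: unit)
    moreover have "\<bar>interaction n w (\<lambda>i. z $ i * (u i)\<^sup>2)\<bar> \<le> 26363 / 10000 * (n * sqrt n)"
      by (rule abs_interaction_le[OF w_sym w_diag w_vert])
        (simp_all add: norm_mult norm_power unit zabs)
    moreover have "- (\<Sum>i<n. \<Sum>j<n. w i j * (z $ i * z $ j)) \<le> n * sqrt n / 20"
      using signal by (simp add: w_def sum_negf)
    moreover have "0 \<le> n * sqrt n" by simp
    ultimately have "interaction n w u - (\<Sum>i<n. \<Sum>j<n. w i j * (z $ i * z $ j)) / 2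
        - interaction n w (\<lambda>i. z $ i * (u i)\<^sup>2) / 2 \<le> 398 / 100 * (n * sqrt n)"
      by linarith
    moreover have "0 \<le> \<sigma>" using lam by (simp add: \<sigma>_def)
    ultimately show ?thesis by (intro add_left_mono mult_left_mono)
  qed
  also have "\<sigma> * (398 / 100 * (n * sqrt n)) = 398 / 100 * (real n)\<^sup>2 / lam"
  proof -
    have "\<sigma> * (c * (n * sqrt n)) = (sqrt n * sqrt n) * (c * n) / lam" for c :: real
      by (simp add: \<sigma>_def)
    also have "(sqrt n * sqrt n) * (c * n) / lam = c * (real n)\<^sup>2 / lam" for c :: real
      by (simp add: power2_eq_square)
    finally show ?thesis .
  qed
  also have "398 / 100 * (real n)\<^sup>2 / lam \<le> 398 / 100 * (real n)\<^sup>2 / 8"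
    using lam by (intro divide_left_mono) auto
  \<comment> \<open>Here \<open>1 / 2 - 3.98 / 8 = 1 / 400\<close>, the square of
    \<open>1 / 20\<close>.\<close>
  finally have "(real n / 20)\<^sup>2 \<le> N\<^sup>2"
    by (simp add: power2_eq_square)
  then have "real n / 20 \<le> N"
    by (rule power2_le_imp_le) (simp add: N_def norm2_def)
  then show ?thesis by (simp add: N_def)
qed

section \<open>Measurability\<close>

text \<open>A non-measurable set has measure 0, so the event itself must be shown to be measurable.  Its
  complement is a countable union of preimages of closed sets, each of them the projection of a
  closed set along the compact set of all \<open>Q\<close>.\<close>

definition continuous_mat :: "nat \<Rightarrow> nat \<Rightarrow> ('p::topological_space \<Rightarrow> real mat) \<Rightarrow> bool" where
  "continuous_mat n m F \<longleftrightarrow> (\<forall>p. F p \<in> carrier_mat n m) \<and>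
    (\<forall>i<n. \<forall>j<m. continuous_on UNIV (\<lambda>p. F p $$ (i, j)))"

lemma continuous_matI:
  assumes "\<And>p. F p \<in> carrier_mat n m"
    and "\<And>i j p. i < n \<Longrightarrow> j < m \<Longrightarrow> F p $$ (i, j) = f i j p"
    and "\<And>i j. i < n \<Longrightarrow> j < m \<Longrightarrow> continuous_on UNIV (f i j)"
  shows "continuous_mat n m F"
  using assms by (auto simp: continuous_mat_def)

lemma continuous_matD:
  assumes "continuous_mat n m F"
  shows "F p \<in> carrier_mat n m" "i < n \<Longrightarrow> j < m \<Longrightarrow> continuous_on UNIV (\<lambda>p. F p $$ (i, j))"
    "dim_row (F p) = n" "dim_col (F p) = m"
  using assms by (auto simp: continuous_mat_def)

lemma continuous_mat_mult:
  assumes F: "continuous_mat n m F" and G: "continuous_mat m k G"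
  shows "continuous_mat n k (\<lambda>p. F p * G p)"
proof (rule continuous_matI)
  show "F p * G p \<in> carrier_mat n k" for p
    using continuous_matD[OF F] continuous_matD[OF G] by auto
  show "(F p * G p) $$ (i, j) = (\<Sum>l<m. F p $$ (i, l) * G p $$ (l, j))" if "i < n" "j < k" for i j p
    using that continuous_matD[OF F] continuous_matD[OF G] by (simp add: scalar_prod_def atLeast0LessThan)
  show "continuous_on UNIV (\<lambda>p. \<Sum>l<m. F p $$ (i, l) * G p $$ (l, j))" if "i < n" "j < k" for i j
    using that continuous_matD(2)[OF F] continuous_matD(2)[OF G] by (intro continuous_intros) auto
qed

lemma continuous_mat_transpose:
  assumes F: "continuous_mat n m F"
  shows "continuous_mat m n (\<lambda>p. (F p)\<^sup>T)"
  by (rule continuous_matI[where f = "\<lambda>i j p. F p $$ (j, i)"])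
    (use continuous_matD[OF F] in auto)

lemma continuous_mat_minus:
  assumes F: "continuous_mat n m F" and G: "continuous_mat n m G"
  shows "continuous_mat n m (\<lambda>p. F p - G p)"
  by (rule continuous_matI[where f = "\<lambda>i j p. F p $$ (i, j) - G p $$ (i, j)"])
    (use continuous_matD[OF F] continuous_matD[OF G] in \<open>auto intro!: continuous_intros minus_carrier_mat\<close>)

lemma continuous_mat_hadamard:
  assumes F: "continuous_mat n m F" and G: "continuous_mat n m G"
  shows "continuous_mat n m (\<lambda>p. hadamard (F p) (G p))"
  by (rule continuous_matI[where f = "\<lambda>i j p. F p $$ (i, j) * G p $$ (i, j)"])
    (use continuous_matD[OF F] continuous_matD[OF G] in \<open>auto simp: hadamard_def intro!: continuous_intros\<close>)

lemma continuous_mat_ddiag: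
  assumes F: "continuous_mat n n F"
  shows "continuous_mat n n (\<lambda>p. ddiag (F p))"
proof (rule continuous_matI)
  show "ddiag (F p) $$ (i, j) = (if i = j then F p $$ (i, i) else 0)" if "i < n" "j < n" for i j p
    using that continuous_matD[OF F] by (simp add: ddiag_def mat_diag_def)
  show "continuous_on UNIV (\<lambda>p. if i = j then F p $$ (i, i) else 0)" if "i < n" "j < n" for i j
    using that continuous_matD(2)[OF F] by (cases "i = j") auto
qed (use continuous_matD[OF F] in \<open>auto simp: ddiag_def mat_diag_def\<close>)

lemma continuous_mat_observation:
  assumes F: "continuous_mat n n F" and z: "z \<in> carrier_vec n"
  shows "continuous_mat n n (\<lambda>p. observation \<sigma> z (F p))"
  by (rule continuous_matI[where f = "\<lambda>i j p. z $ i * z $ j + \<sigma> * F p $$ (i, j)"])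
    (use z continuous_matD[OF F] in \<open>auto simp: observation_def outer_square_def intro!: continuous_intros\<close>)

lemma closed_mat_eq:
  assumes F: "continuous_mat n m F" and G: "continuous_mat n m G"
  shows "closed {p. F p = G p}"
proof -
  have "{p. F p = G p} = (\<Inter>i<n. \<Inter>j<m. {p. F p $$ (i, j) = G p $$ (i, j)})"
    using continuous_matD[OF F] continuous_matD[OF G] by (auto intro!: eq_matI)
  also have "closed \<dots>"
    using continuous_matD(2)[OF F] continuous_matD(2)[OF G]
    by (intro closed_INT ballI closed_Collect_eq) auto
  finally show ?thesis .
qed

lemma continuous_mat_const: "A \<in> carrier_mat n m \<Longrightarrow> continuous_mat n m (\<lambda>_. A)"
  by (auto simp: continuous_mat_def)

text \<open>For each fixed \<open>x\<close> the inequality is closed in \<open>p\<close>, and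
  arbitrary intersections of closed sets are closed.\<close>

lemma closed_pos_semidef:
  assumes F: "continuous_mat n n F"
  shows "closed {p. pos_semidef n (F p)}"
proof -
  have form: "x \<bullet> (F p *\<^sub>v x) = (\<Sum>i<n. x $ i * (\<Sum>j<n. F p $$ (i, j) * x $ j))"
    if "x \<in> carrier_vec n" for x p
    using that continuous_matD[OF F] by (simp add: scalar_prod_def atLeast0LessThan)
  have "{p. pos_semidef n (F p)} = {p. (F p)\<^sup>T = F p} \<inter>
      {p. \<forall>x. x \<in> carrier_vec n \<longrightarrow> 0 \<le> (\<Sum>i<n. x $ i * (\<Sum>j<n. F p $$ (i, j) * x $ j))}"
    using continuous_matD(1)[OF F] by (auto simp: pos_semidef_def form)
  also have "closed \<dots>"
  proof (intro closed_Int closed_mat_eq[OF continuous_mat_transpose[OF F] F]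
      closed_Collect_all closed_Collect_imp closed_Collect_le)
    show "continuous_on UNIV (\<lambda>p. \<Sum>i<n. x $ i * (\<Sum>j<n. F p $$ (i, j) * x $ j))" for x
      using continuous_matD(2)[OF F] by (intro continuous_intros) auto
  qed auto
  finally show ?thesis .
qed

lemma closed_second_order_critical:
  assumes A: "continuous_mat n n A" and Q: "continuous_mat n 2 Q"
  shows "closed {p. second_order_critical n (A p) (Q p)}"
proof -
  have row: "norm2 (row (Q p) i) = sqrt (\<Sum>j<2. (Q p $$ (i, j))\<^sup>2)" if "i < n" for i p
    using that continuous_matD[OF Q] by (simp add: norm2_def L2_set_def)
  have eq: "{p. second_order_critical n (A p) (Q p)} =
      (\<Inter>i<n. {p. sqrt (\<Sum>j<2. (Q p $$ (i, j))\<^sup>2) = 1}) \<inter>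
      {p. (ddiag (A p * Q p * (Q p)\<^sup>T) - A p) * Q p = 0\<^sub>m n 2} \<inter>
      {p. pos_semidef n (ddiag (A p * Q p * (Q p)\<^sup>T) - hadamard (A p) (Q p * (Q p)\<^sup>T))}"
    using continuous_matD(1)[OF Q] by (auto simp: second_order_critical_def feasible_def row)
  have D: "continuous_mat n n (\<lambda>p. ddiag (A p * Q p * (Q p)\<^sup>T))"
    by (rule continuous_mat_ddiag[OF continuous_mat_mult[OF continuous_mat_mult[OF A Q] continuous_mat_transpose[OF Q]]])
  have H: "continuous_mat n n (\<lambda>p. hadamard (A p) (Q p * (Q p)\<^sup>T))"
    by (rule continuous_mat_hadamard[OF A continuous_mat_mult[OF Q continuous_mat_transpose[OF Q]]])
  have row_closed: "closed (\<Inter>i<n. {p. sqrt (\<Sum>j<2. (Q p $$ (i, j))\<^sup>2) = 1})"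
    using continuous_matD(2)[OF Q] by (intro closed_INT ballI closed_Collect_eq continuous_intros) auto
  show ?thesis
    unfolding eq
    by (intro closed_Int row_closed closed_pos_semidef continuous_mat_minus D H
        closed_mat_eq[OF continuous_mat_mult[OF continuous_mat_minus[OF D A] Q]] continuous_mat_const zero_carrier_mat)
qed

text \<open>Projecting along a compact factor is a closed map (tube lemma).\<close>

lemma closed_projection_compact:
  fixes K :: "'a::topological_space set" and T :: "('a \<times> 'b::topological_space) set"
  assumes "compact K" "closed T"
  shows "closed {y. \<exists>x\<in>K. (x, y) \<in> T}"
proof -
  have top: "prod_topology (top_of_set K) euclidean = top_of_set (K \<times> (UNIV :: 'b set))"
    using prod_topology_subtopology_eu[of K UNIV] by simp
  have "closed_map (prod_topology (top_of_set K) euclidean) (euclidean :: 'b topology) snd"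
    by (rule closed_map_snd) (use \<open>compact K\<close> in \<open>simp add: compact_space_subtopology\<close>)
  moreover have "closedin (prod_topology (top_of_set K) euclidean) (K \<times> UNIV \<inter> T)"
    unfolding top by (rule closedin_closed_Int[OF \<open>closed T\<close>])
  ultimately have "closedin euclidean (snd ` (K \<times> UNIV \<inter> T))"
    unfolding closed_map_def by blast
  moreover have "snd ` (K \<times> UNIV \<inter> T) = {y. \<exists>x\<in>K. (x, y) \<in> T}"
    by force
  ultimately show ?thesis by simp
qed

text \<open>Tychonoff's theorem, for the space of candidate matrices.\<close>

lemma compact_PiE_UNIV:
  fixes S :: "'i \<Rightarrow> 'a::topological_space set"
  assumes "\<And>i. compact (S i)"
  shows "compact (PiE UNIV S)"
proof -
  have "compactin (product_topology (\<lambda>_. euclidean) UNIV) (PiE UNIV S)"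
    unfolding compactin_PiE using assms by simp
  then show ?thesis
    by (simp add: euclidean_product_topology)
qed

lemma measurable_ex_second_order_critical:
  assumes W: "gaussian_noise M n W" and z: "z \<in> carrier_vec n"
  shows "{\<omega> \<in> space M. \<exists>Q. second_order_critical n (observation \<sigma> z (W \<omega>)) Q \<and> norm2 (Q\<^sup>T *\<^sub>v z) \<le> \<delta>} \<in> sets M"
proof -
  \<comment> \<open>Matrices are coded as functions on all pairs of indices. Unit rows have entries
    in \<open>{-1..1}\<close>, so this compact cube contains a code of every feasible
    \<open>Q\<close>.\<close>
  define K where "K = PiE UNIV (\<lambda>_::nat. PiE UNIV (\<lambda>_::nat. {-1..1::real}))"
  define Qm where "Qm p = mat n 2 (\<lambda>(i, j). fst p i j)" for p :: "(nat \<Rightarrow> nat \<Rightarrow> real) \<times> (nat \<Rightarrow> nat \<Rightarrow> real)"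
  define Am where "Am p = observation \<sigma> z (mat n n (\<lambda>(i, j). snd p i j))"
    for p :: "(nat \<Rightarrow> nat \<Rightarrow> real) \<times> (nat \<Rightarrow> nat \<Rightarrow> real)"
  \<comment> \<open>The non-strict bound by \<open>\<delta>\<close> keeps this set closed.\<close>
  define T where "T = {p. second_order_critical n (Am p) (Qm p) \<and> norm2 ((Qm p)\<^sup>T *\<^sub>v z) \<le> \<delta>}"
  define w where "w \<omega> i j = (if i < n \<and> j < n then W \<omega> $$ (i, j) else 0)" for \<omega> i j
  have "compact K"
    unfolding K_def by (intro compact_PiE_UNIV) simp
  have coord: "continuous_on UNIV (\<lambda>p :: (nat \<Rightarrow> nat \<Rightarrow> real) \<times> (nat \<Rightarrow> nat \<Rightarrow> real). fst p i j)"
    "continuous_on UNIV (\<lambda>p :: (nat \<Rightarrow> nat \<Rightarrow> real) \<times> (nat \<Rightarrow> nat \<Rightarrow> real). snd p i j)" for i j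
    by (rule continuous_on_product_then_coordinatewise[OF
          continuous_on_product_then_coordinatewise[OF continuous_on_fst[OF continuous_on_id]]]
        continuous_on_product_then_coordinatewise[OF
          continuous_on_product_then_coordinatewise[OF continuous_on_snd[OF continuous_on_id]]])+
  have Q: "continuous_mat n 2 Qm"
    by (rule continuous_matI[where f = "\<lambda>i j p. fst p i j"]) (auto simp: Qm_def coord)
  have "continuous_mat n n (\<lambda>p::(nat \<Rightarrow> nat \<Rightarrow> real) \<times> (nat \<Rightarrow> nat \<Rightarrow> real). mat n n (\<lambda>(i, j). snd p i j))"
    by (rule continuous_matI[where f = "\<lambda>i j p. snd p i j"]) (auto simp: coord)
  then have A: "continuous_mat n n Am"
    unfolding Am_def by (rule continuous_mat_observation[OF _ z])
  have norm: "norm2 ((Qm p)\<^sup>T *\<^sub>v z) = sqrt (\<Sum>j<2. (\<Sum>i<n. Qm p $$ (i, j) * z $ i)\<^sup>2)" for p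
    using continuous_matD[OF Q] z by (simp add: norm2_def L2_set_def scalar_prod_def atLeast0LessThan)
  have "closed T"
    unfolding T_def norm
  proof (intro closed_Collect_conj closed_second_order_critical[OF A Q] closed_Collect_le)
    show "continuous_on UNIV (\<lambda>p. sqrt (\<Sum>j<2. (\<Sum>i<n. Qm p $$ (i, j) * z $ i)\<^sup>2))"
      using continuous_matD(2)[OF Q] by (intro continuous_intros) auto
  qed auto
  have "w \<in> borel_measurable M"
  proof (intro measurable_coordinatewise_then_product)
    show "(\<lambda>\<omega>. w \<omega> i j) \<in> borel_measurable M" for i j
      unfolding w_def using gaussian_noise_entry_measurable[OF W, of i j] by (cases "i < n \<and> j < n") auto
  qed
  moreover have "{y. \<exists>x\<in>K. (x, y) \<in> T} \<in> sets borel"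
    by (intro borel_closed closed_projection_compact \<open>compact K\<close> \<open>closed T\<close>)
  ultimately have "w -` {y. \<exists>x\<in>K. (x, y) \<in> T} \<inter> space M \<in> sets M"
    by (rule measurable_sets)
  also have "w -` {y. \<exists>x\<in>K. (x, y) \<in> T} \<inter> space M =
      {\<omega> \<in> space M. \<exists>Q. second_order_critical n (observation \<sigma> z (W \<omega>)) Q \<and> norm2 (Q\<^sup>T *\<^sub>v z) \<le> \<delta>}"
  proof -
    have A_eq: "Am (q, w \<omega>) = observation \<sigma> z (W \<omega>)" if "\<omega> \<in> space M" for q \<omega>
    proof -
      have "W \<omega> \<in> carrier_mat n n" using W that by (auto simp: gaussian_noise_def)
      then have "mat n n (\<lambda>(i, j). w \<omega> i j) = W \<omega>"
        by (auto intro!: eq_matI simp: w_def)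
      then show ?thesis by (simp add: Am_def)
    qed
    have Q_ex: "\<exists>q\<in>K. \<forall>v. Qm (q, v) = Q" if crit: "second_order_critical n A Q" for A Q
    proof -
      have Q: "Q \<in> carrier_mat n 2" and unit: "\<And>i. i < n \<Longrightarrow> norm2 (row Q i) = 1"
        using crit by (auto simp: second_order_critical_def feasible_def)
      have le: "\<bar>Q $$ (i, j)\<bar> \<le> 1" if "i < n" "j < 2" for i j
      proof -
        have "(row Q i $ j)\<^sup>2 \<le> (\<Sum>j<dim_vec (row Q i). (row Q i $ j)\<^sup>2)"
          using Q that by (intro member_le_sum) auto
        then have "\<bar>row Q i $ j\<bar> \<le> norm2 (row Q i)"
          unfolding norm2_def L2_set_def by (intro real_le_rsqrt) simp
        then show ?thesis using unit[of i] Q that by simp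
      qed
      let ?q = "\<lambda>i j. if i < n \<and> j < 2 then Q $$ (i, j) else 0"
      have "?q \<in> K" using le by (auto simp: K_def abs_le_iff)
      moreover have "Qm (?q, v) = Q" for v
        using Q by (auto intro!: eq_matI simp: Qm_def)
      ultimately show ?thesis by blast
    qed
    show ?thesis
      using A_eq Q_ex unfolding T_def by (auto 0 3) metis+
  qed
  finally show ?thesis .
qed

section \<open>Union bound\<close>

lemma gaussian_noise_event:
  assumes W: "gaussian_noise M n W"
  shows "{\<omega> \<in> space M. t \<le> (\<Sum>i<n. \<Sum>j<n. W \<omega> $$ (i, j) * b i j)} \<in> sets M"
proof -
  have [measurable]: "(\<lambda>\<omega>. \<Sum>i<n. \<Sum>j<n. W \<omega> $$ (i, j) * b i j) \<in> borel_measurable M"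
    by (intro borel_measurable_sum borel_measurable_times gaussian_noise_entry_measurable[OF W]) auto
  show ?thesis by measurable
qed

text \<open>The sign \<open>s\<close> reduces the absolute value to one-sided bounds. The factor
  \<open>9 / 4\<close> has to satisfy two demands:
  \<open>9 / 4 / cos\<^sup>2 (pi / 8) < 8 / 3\<close> for the deterministic part, and
  \<open>9 / 4 * sqrt 2 - 1 > ln 8\<close> for the union bound.\<close>

definition vertex_deviation :: "'a measure \<Rightarrow> nat \<Rightarrow> ('a \<Rightarrow> real mat) \<Rightarrow> 'a set" where
  "vertex_deviation M n W = (\<Union>(f, s)\<in>({..<n} \<rightarrow>\<^sub>E {..<8}) \<times> {1, -1}. {\<omega> \<in> space M.
     9 / 4 * (n * sqrt n) \<le>
     (\<Sum>i<n. \<Sum>j<n. W \<omega> $$ (i, j) * (s * Re (vertex (f i) * cnj (vertex (f j)))))})"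

lemma vertex_deviation_sets:
  assumes "gaussian_noise M n W"
  shows "vertex_deviation M n W \<in> sets M"
  unfolding vertex_deviation_def case_prod_unfold
  by (intro sets.finite_UN finite_cartesian_product finite_PiE gaussian_noise_event[OF assms]) auto

lemma abs_interaction_le_if_not_vertex_deviation:
  assumes \<omega>: "\<omega> \<in> space M" "\<omega> \<notin> vertex_deviation M n W" and f: "f \<in> {..<n} \<rightarrow>\<^sub>E {..<8}"
  shows "\<bar>interaction n (\<lambda>i j. W \<omega> $$ (i, j)) (\<lambda>i. vertex (f i))\<bar> \<le> 9 / 4 * (n * sqrt n)"
proof -
  let ?I = "interaction n (\<lambda>i j. W \<omega> $$ (i, j)) (\<lambda>i. vertex (f i))"
  have le: "s * ?I \<le> 9 / 4 * (n * sqrt n)" if s: "s \<in> {1, -1}" for s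
  proof (rule ccontr)
    assume "\<not> ?thesis"
    moreover have "s * ?I =
        (\<Sum>i<n. \<Sum>j<n. W \<omega> $$ (i, j) * (s * Re (vertex (f i) * cnj (vertex (f j)))))"
      unfolding interaction_def sum_distrib_left by (intro sum.cong refl mult.left_commute)
    ultimately have "9 / 4 * (n * sqrt n) \<le>
        (\<Sum>i<n. \<Sum>j<n. W \<omega> $$ (i, j) * (s * Re (vertex (f i) * cnj (vertex (f j)))))"
      by linarith
    then have "\<omega> \<in> vertex_deviation M n W"
      unfolding vertex_deviation_def case_prod_unfold using s f \<omega>(1)
      by (intro UN_I[of "(f, s)"] CollectI conjI SigmaI) (simp_all only: fst_conv snd_conv)
    with \<omega>(2) show False ..
  qed
  from le[of 1] le[of "-1"] show ?thesis
    unfolding abs_le_iff by simp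
qed

lemma ln_8_le: "ln 8 \<le> (25 / 12 :: real)"
proof -
  have "ln (2 ^ 3 :: real) = 3 * ln 2"
    by (subst ln_realpow) auto
  then show ?thesis using ln2_le_25_over_36 by simp
qed

text \<open>The sum of squared coefficients depends on \<open>f\<close> and can reach
  \<open>n\<^sup>2\<close>. Summing its exponential over \<open>f\<close>, instead of taking the
  worst case, costs only a polynomial factor over the value \<open>n\<^sup>2 / 2\<close>.\<close>

lemma measure_vertex_deviation_le:
  assumes W: "gaussian_noise M n W" and n: "n > 0"
  shows "measure M (vertex_deviation M n W) \<le> 2 * (2 * real n + 1)\<^sup>2 * exp (- real n / 20)"
proof -
  let ?F = "{..<n} \<rightarrow>\<^sub>E {..<8::nat}"
  let ?r = "\<lambda>f i j. Re (vertex (f i) * cnj (vertex (f j)))"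
  let ?v = "\<lambda>f. (cmod (\<Sum>i<n. (vertex (f i))\<^sup>2))\<^sup>2 / n"
  \<comment> \<open>Chosen so that \<open>\<beta>\<^sup>2 / 2 = 1 / n\<close>, the factor in the
    exponent of \<open>sum_exp_vertex_square_le\<close>.\<close>
  define \<beta> where "\<beta> = sqrt (2 / n)"
  have \<beta>: "\<beta> > 0" "\<beta>\<^sup>2 = 2 / n" using n by (auto simp: \<beta>_def)
  have \<beta>t: "\<beta> * (9 / 4 * (n * sqrt n)) \<ge> 318 / 100 * n"
  proof -
    have "\<beta> * sqrt n = sqrt 2"
      using n by (simp add: \<beta>_def flip: real_sqrt_mult)
    then have "\<beta> * (9 / 4 * (n * sqrt n)) = 9 / 4 * n * sqrt 2"
      by (metis mult.assoc mult.commute)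
    moreover have "9 / 4 * real n * (14142 / 10000) \<le> 9 / 4 * n * sqrt 2"
      by (intro mult_left_mono sqrt_2_ge) auto
    ultimately show ?thesis by linarith
  qed
  have one: "measure M {\<omega> \<in> space M. 9 / 4 * (n * sqrt n) \<le> (\<Sum>i<n. \<Sum>j<n. W \<omega> $$ (i, j) * (s * ?r f i j))}
      \<le> exp (- (218 / 100) * n) * exp (?v f)" if "s \<in> {1, -1}" for f s
  proof -
    have "(\<Sum>i<n. \<Sum>j<n. (s * ?r f i j)\<^sup>2) = (\<Sum>i<n. \<Sum>j<n. (?r f i j)\<^sup>2)"
      using that by (intro sum.cong refl) (auto simp: power_mult_distrib simp del: times_complex.sel)
    also have "\<dots> = (real n)\<^sup>2 / 2 + (cmod (\<Sum>i<n. (vertex (f i))\<^sup>2))\<^sup>2 / 2"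
      by (rule sum_sum_Re_mult_cnj_square) simp
    finally have eq: "\<beta>\<^sup>2 * (\<Sum>i<n. \<Sum>j<n. (s * ?r f i j)\<^sup>2) = n + ?v f"
      using n unfolding \<beta>(2) by (simp add: power2_eq_square field_simps)
    have "measure M {\<omega> \<in> space M. 9 / 4 * (n * sqrt n) \<le> (\<Sum>i<n. \<Sum>j<n. W \<omega> $$ (i, j) * (s * ?r f i j))}
        \<le> exp (\<beta>\<^sup>2 * (\<Sum>i<n. \<Sum>j<n. (s * ?r f i j)\<^sup>2) - \<beta> * (9 / 4 * (n * sqrt n)))"
      by (rule gaussian_noise_chernoff[OF W _ \<beta>(1)]) (simp only: Re_mult_cnj_commute)
    also have "exp (\<beta>\<^sup>2 * (\<Sum>i<n. \<Sum>j<n. (s * ?r f i j)\<^sup>2) - \<beta> * (9 / 4 * (n * sqrt n))) \<le> exp (- (218 / 100) * n + ?v f)"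
      unfolding eq exp_le_cancel_iff using \<beta>t by linarith
    finally show ?thesis unfolding exp_add .
  qed
  have "measure M (vertex_deviation M n W) \<le>
      (\<Sum>p\<in>?F \<times> {1, -1}. measure M {\<omega> \<in> space M. 9 / 4 * (n * sqrt n) \<le>
        (\<Sum>i<n. \<Sum>j<n. W \<omega> $$ (i, j) * (snd p * ?r (fst p) i j))})"
    unfolding vertex_deviation_def case_prod_unfold
    by (intro measure_UNION_le finite_cartesian_product finite_PiE gaussian_noise_event[OF W]) auto
  also have "\<dots> \<le> (\<Sum>p\<in>?F \<times> {1, -1::real}. exp (- (218 / 100) * n) * exp (?v (fst p)))"
    by (intro sum_mono one) (simp only: mem_Times_iff)
  also have "\<dots> = 2 * (exp (- (218 / 100) * n) * (\<Sum>f\<in>?F. exp (?v f)))"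
    by (simp add: sum.cartesian_product' sum_distrib_left)
  also have "\<dots> \<le> 2 * (exp (- (218 / 100) * n) * ((2 * real n + 1)\<^sup>2 * 8 ^ n))"
    by (intro mult_left_mono sum_exp_vertex_square_le n) auto
  also have "(8::real) ^ n = exp (n * ln 8)"
    by (simp add: exp_of_nat_mult)
  also have "2 * (exp (- (218 / 100) * n) * ((2 * real n + 1)\<^sup>2 * exp (n * ln 8))) =
      2 * (2 * real n + 1)\<^sup>2 * exp (- (218 / 100) * n + n * ln 8)"
    by (simp only: exp_add mult_ac)
  \<comment> \<open>This uses \<open>25 / 12 - 2.18 < - 1 / 20\<close>.\<close>
  also have "\<dots> \<le> 2 * (2 * real n + 1)\<^sup>2 * exp (- real n / 20)"
  proof -
    have "n * ln 8 \<le> n * (25 / 12 :: real)"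
      by (intro mult_left_mono ln_8_le) simp
    then show ?thesis by (intro mult_left_mono) auto
  qed
  finally show ?thesis .
qed

text \<open>Only this sign hurts the estimate. The sum fluctuates on the scale \<open>n\<close>, far
  below the threshold.\<close>

definition signal_deviation :: "'a measure \<Rightarrow> nat \<Rightarrow> real vec \<Rightarrow> ('a \<Rightarrow> real mat) \<Rightarrow> 'a set" where
  "signal_deviation M n z W =
    {\<omega> \<in> space M. n * sqrt n / 20 \<le> (\<Sum>i<n. \<Sum>j<n. W \<omega> $$ (i, j) * - (z $ i * z $ j))}"

lemma measure_signal_deviation_le:
  assumes W: "gaussian_noise M n W" and z: "sign_vec n z" and n: "n > 0"
  shows "measure M (signal_deviation M n z W) \<le> exp (- real n / 1600)"
proof -
  \<comment> \<open>The minimiser of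
    \<open>\<beta>\<^sup>2 * n\<^sup>2 - \<beta> * (n * sqrt n / 20)\<close>.\<close>
  define \<beta> where "\<beta> = 1 / (40 * sqrt n)"
  have "\<beta> > 0" using n by (simp add: \<beta>_def)
  have "(\<Sum>i<n. \<Sum>j<n. (- (z $ i * z $ j))\<^sup>2) = (\<Sum>i<n. \<Sum>j<n. 1)"
    unfolding power2_eq_square minus_mult_minus
    by (intro sum.cong refl sign_vec_mult_self[OF z]) auto
  then have "\<beta>\<^sup>2 * (\<Sum>i<n. \<Sum>j<n. (- (z $ i * z $ j))\<^sup>2) = n / 1600"
    using n by (simp add: \<beta>_def power_divide power_mult_distrib power2_eq_square[of "real n"])
  moreover have "\<beta> * (n * sqrt n / 20) = n / 800"
    using n by (simp add: \<beta>_def)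
  moreover have "measure M (signal_deviation M n z W) \<le>
      exp (\<beta>\<^sup>2 * (\<Sum>i<n. \<Sum>j<n. (- (z $ i * z $ j))\<^sup>2) - \<beta> * (n * sqrt n / 20))"
    unfolding signal_deviation_def
    by (rule gaussian_noise_chernoff[OF W _ \<open>\<beta> > 0\<close>]) simp
  ultimately have "measure M (signal_deviation M n z W) \<le> exp (n / 1600 - n / 800)"
    by (simp only:)
  then show ?thesis by simp
qed

text \<open>Failure of the event is a strict inequality, whereas the compactness argument needs a
  non-strict one; the bounds \<open>n * \<epsilon> - 1 / real (Suc k)\<close> exhaust it.\<close>

lemma correlation_event_sets:
  assumes W: "gaussian_noise M n W" and z: "z \<in> carrier_vec n" and n: "n > 0"
  shows "{\<omega> \<in> space M. \<forall>Q. second_order_critical n (observation \<sigma> z (W \<omega>)) Q \<longrightarrow>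
    1 / real n * norm2 (Q\<^sup>T *\<^sub>v z) \<ge> \<epsilon>} \<in> sets M"
proof -
  let ?B = "\<lambda>\<delta>. {\<omega> \<in> space M. \<exists>Q. second_order_critical n (observation \<sigma> z (W \<omega>)) Q \<and>
    norm2 (Q\<^sup>T *\<^sub>v z) \<le> \<delta>}"
  have less_iff: "1 / real n * x < \<epsilon> \<longleftrightarrow> (\<exists>k. x \<le> n * \<epsilon> - 1 / real (Suc k))" for x
  proof
    assume "1 / real n * x < \<epsilon>"
    then have "0 < n * \<epsilon> - x" using n by (simp add: field_simps)
    then obtain k where "1 / real (Suc k) < n * \<epsilon> - x" using nat_approx_posE by blast
    then show "\<exists>k. x \<le> n * \<epsilon> - 1 / real (Suc k)" by (intro exI[of _ k]) linarith
  next
    assume "\<exists>k. x \<le> n * \<epsilon> - 1 / real (Suc k)"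
    then obtain k where "x \<le> n * \<epsilon> - 1 / real (Suc k)" ..
    moreover have "1 / real (Suc k) > 0" by simp
    ultimately have "x < n * \<epsilon>" by linarith
    then show "1 / real n * x < \<epsilon>" using n by (simp add: field_simps)
  qed
  have "{\<omega> \<in> space M. \<forall>Q. second_order_critical n (observation \<sigma> z (W \<omega>)) Q \<longrightarrow>
      1 / real n * norm2 (Q\<^sup>T *\<^sub>v z) \<ge> \<epsilon>} = space M - (\<Union>k. ?B (n * \<epsilon> - 1 / real (Suc k)))"
    unfolding not_less[symmetric] less_iff by blast
  also have "\<dots> \<in> sets M"
    by (intro sets.Diff sets.top sets.countable_UN'' measurable_ex_second_order_critical W z) simp_all
  finally show ?thesis .
qed

section \<open>Convergence of the probability to 1\<close>

theorem theorem1: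
  fixes lam :: real
  assumes "lam > 8"
  shows "\<exists>\<epsilon> > 0. \<forall>(z :: nat \<Rightarrow> real vec) (M :: nat \<Rightarrow> 'a measure) (W :: nat \<Rightarrow> 'a \<Rightarrow> real mat).
    (\<forall>n \<ge> 1. sign_vec n (z n) \<and> gaussian_noise (M n) n (W n)) \<longrightarrow>
    (\<lambda>n. \<P>(\<omega> in M n.
        \<forall>Q. second_order_critical n (observation (sqrt (real n) / lam) (z n) (W n \<omega>)) Q \<longrightarrow>
            1 / real n * norm2 (Q\<^sup>T *\<^sub>v z n) \<ge> \<epsilon>)) \<longlonglongrightarrow> 1"
proof (intro exI[of _ "1 / 20"] conjI allI impI)
  fix z :: "nat \<Rightarrow> real vec" and M :: "nat \<Rightarrow> 'a measure" and W :: "nat \<Rightarrow> 'a \<Rightarrow> real mat"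
  assume *: "\<forall>n \<ge> 1. sign_vec n (z n) \<and> gaussian_noise (M n) n (W n)"
  let ?E = "\<lambda>n. {\<omega> \<in> space (M n). \<forall>Q.
      second_order_critical n (observation (sqrt (real n) / lam) (z n) (W n \<omega>)) Q \<longrightarrow>
      1 / real n * norm2 (Q\<^sup>T *\<^sub>v z n) \<ge> 1 / 20}"
  let ?b = "\<lambda>n. 2 * (2 * real n + 1)\<^sup>2 * exp (- real n / 20) + exp (- real n / 1600)"
  have bounds: "1 - ?b n \<le> measure (M n) (?E n) \<and> measure (M n) (?E n) \<le> 1" if n: "n \<ge> 1" for n
  proof -
    have z: "sign_vec n (z n)" and W: "gaussian_noise (M n) n (W n)"
      using * n by auto
    interpret prob_space "M n" using W by (simp add: gaussian_noise_def)
    let ?B = "vertex_deviation (M n) n (W n) \<union> signal_deviation (M n) n (z n) (W n)"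
    have sets: "vertex_deviation (M n) n (W n) \<in> events" "signal_deviation (M n) n (z n) (W n) \<in> events"
      unfolding signal_deviation_def by (intro vertex_deviation_sets gaussian_noise_event W)+
    have "?E n \<in> events"
      using z n by (intro correlation_event_sets[OF W]) (auto simp: sign_vec_def)
    \<comment> \<open>Off the two bad events the deterministic estimate holds for all critical
      points simultaneously.\<close>
    have "space (M n) - ?B \<subseteq> ?E n"
    proof (intro subsetI CollectI conjI allI impI)
      fix \<omega> Q
      assume "\<omega> \<in> space (M n) - ?B"
      then show "\<omega> \<in> space (M n)" by blast
      assume "\<omega> \<in> space (M n) - ?B"
      then have \<omega>: "\<omega> \<in> space (M n)" "\<omega> \<notin> vertex_deviation (M n) n (W n)"
        "\<omega> \<notin> signal_deviation (M n) n (z n) (W n)" by auto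
      assume crit: "second_order_critical n (observation (sqrt (real n) / lam) (z n) (W n \<omega>)) Q"
      have "n / 20 \<le> norm2 (Q\<^sup>T *\<^sub>v z n)"
      proof (rule second_order_critical_correlation[OF assms z])
        show "W n \<omega> \<in> carrier_mat n n" using W \<omega>(1) by (auto simp: gaussian_noise_def)
        show "(\<Sum>i<n. \<Sum>j<n. W n \<omega> $$ (i, j) * - (z n $ i * z n $ j)) \<le> n * sqrt n / 20"
          using \<omega> by (simp add: signal_deviation_def)
      qed (use gaussian_noise_sym[OF W \<omega>(1)] gaussian_noise_diag[OF W \<omega>(1)]
          abs_interaction_le_if_not_vertex_deviation[OF \<omega>(1,2)] crit in auto)
      then show "1 / 20 \<le> 1 / real n * norm2 (Q\<^sup>T *\<^sub>v z n)"
        using n by (simp add: field_simps)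
    qed
    then have "prob (space (M n) - ?B) \<le> prob (?E n)"
      using \<open>?E n \<in> events\<close> by (rule finite_measure_mono)
    moreover have "prob (space (M n) - ?B) = 1 - prob ?B"
      using sets by (intro prob_compl) auto
    moreover have "prob ?B \<le> prob (vertex_deviation (M n) n (W n)) + prob (signal_deviation (M n) n (z n) (W n))"
      using sets by (rule measure_Un_le)
    moreover have "n > 0" using n by simp
    ultimately show ?thesis
      using measure_vertex_deviation_le[OF W \<open>n > 0\<close>] measure_signal_deviation_le[OF W z \<open>n > 0\<close>]
        prob_le_1[of "?E n"] by linarith
  qed
  have lim: "(\<lambda>n. 1 - ?b n) \<longlonglongrightarrow> 1"
    by real_asymp
  show "(\<lambda>n. measure (M n) (?E n)) \<longlonglongrightarrow> 1"
  proof (rule tendsto_sandwich[OF _ _ lim tendsto_const])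
    show "\<forall>\<^sub>F n in sequentially. 1 - ?b n \<le> measure (M n) (?E n)"
      using bounds by (intro eventually_sequentiallyI[of 1]) blast
    show "\<forall>\<^sub>F n in sequentially. measure (M n) (?E n) \<le> 1"
      using bounds by (intro eventually_sequentiallyI[of 1]) blast
  qed
qed simp

end
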